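(* Let $\ell$ and $r$ be positive integers, let $B=\{b_1<b_2<\cdots<b_r\}\subseteq\{1,\dots,n\}$, and let $v_1\ge v_2\ge\cdots\ge v_r$ be integers with $\{v_1,\dots,v_r\}=\{1,\dots,\ell-1\}$. Let $u(v)\in\mathcal W_n$ be the word with $u(v)_{b_j}=v_j$ for $j=1,\dots,r$ and $u(v)_i=\ell$ for $i\notin B$. For $j\in\{1,\dots,r\}$ set $\gamma_j=\ell-v_j$. Then $$\mathrm{sw}(u(v))=\Big(\prod_{b\in B}x_b\Big)\det\Big(h_{\gamma_j+i-j-1}(x_1,\dots,x_{b_j})\Big)_{i,j\in\{1,\dots,r\}}.$$
   Context: Fix a positive integer $n$. Sites are $1,\dots,n$ (with cyclic order $n\to1$ used in the queue action). $\mathcal{W}_n$ is the set of words $u=u_1\cdots u_n$ with letters in $\{1,2,\dots\}$; $1^n$ is the all-$1$ word. The type of $u$ is $\mathbf m=(m_1,m_2,\dots)$ with $m_i$ the number of letters equal to $i$; $p_i(\mathbf m)=m_1+\cdots+m_i$. A queue is a subset $q\subseteq\{1,\dots,n\}$; an $r$-queue has size $r$. For a queue $q$ and $u\in\mathcal W_n$, $w=q(u)$ is defined by: choose a permutation $(i_1,\dots,i_n)$ of $(1,\dots,n)$ with $u_{i_1}\le\cdots\le u_{i_n}$; Phase I: for $i=i_n,\dots,i_{|q|+1}$ in this order, take the first site $j$ weakly to the left of $i$ (cyclically) with $j\notin q$ and $w_j$ unset, and set $w_j=u_i+1$; Phase II: for $i=i_1,\dots,i_{|q|}$ in this order, take the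 first site $j$ weakly to the right of $i$ (cyclically) with $j\in q$ and $w_j$ unset, and set $w_j=u_i$. An MLQ of type $\mathbf m=(m_1,\dots,m_\ell,0,\dots)$ with $p_\ell(\mathbf m)=n$ is a sequence $\mathbf q=(q_1,\dots,q_{\ell-1})$ with $q_i$ a $p_i(\mathbf m)$-queue, acting by $\mathbf q(u)=q_{\ell-1}(\cdots q_1(u)\cdots)$. With commuting indeterminates $x_1,\dots,x_n$, $\mathrm{wt}(\mathbf q)=\prod_i\prod_{j\in q_i}x_j$. For a packed word $u$ (all letters $1,\dots,\max$ occur) of type $\mathbf m$, $\mathrm{sw}(u)=\sum\mathrm{wt}(\mathbf q)$ over all MLQs $\mathbf q$ of type $\mathbf m$ with $\mathbf q(1^n)=u$. $h_k$ is the complete homogeneous symmetric polynomial, with $h_0=1$ and $h_k=0$ for $k<0$. *)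

theory Defs
  imports
    "HOL-Library.Poly_Mapping"
    "HOL-Library.Multiset"
    "Jordan_Normal_Form.Determinant"
begin

text \<open>
  Sites are the natural numbers \<open>1, \<dots>, n\<close>. A word on these sites is a function
  \<open>nat \<Rightarrow> nat\<close> of which only the values on \<open>{1..n}\<close> matter.
\<close>

definition letter_count :: "nat \<Rightarrow> (nat \<Rightarrow> nat) \<Rightarrow> nat \<Rightarrow> nat" where
  "letter_count n u i = card {k \<in> {1..n}. u k = i}"

definition psum :: "(nat \<Rightarrow> nat) \<Rightarrow> nat \<Rightarrow> nat" where
  "psum m i = (\<Sum>k = 1..i. m k)"

definition left_of :: "nat \<Rightarrow> nat \<Rightarrow> nat \<Rightarrow> nat" where
  "left_of n i k = nat ((int i - 1 - int k) mod int n) + 1"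

definition right_of :: "nat \<Rightarrow> nat \<Rightarrow> nat \<Rightarrow> nat" where
  "right_of n i k = (i - 1 + k) mod n + 1"

definition first_left :: "nat \<Rightarrow> nat set \<Rightarrow> nat \<Rightarrow> nat" where
  "first_left n A i = left_of n i (LEAST k. left_of n i k \<in> A)"

definition first_right :: "nat \<Rightarrow> nat set \<Rightarrow> nat \<Rightarrow> nat" where
  "first_right n A i = right_of n i (LEAST k. right_of n i k \<in> A)"

text \<open>A partially built word is a map from sites to letters; unset sites are sent to \<open>None\<close>.\<close>

definition phase1_step ::
  "nat \<Rightarrow> nat set \<Rightarrow> (nat \<Rightarrow> nat) \<Rightarrow> nat \<Rightarrow> (nat \<rightharpoonup> nat) \<Rightarrow> (nat \<rightharpoonup> nat)" where
  "phase1_step n q u i w = w(first_left n {j \<in> {1..n}. j \<notin> q \<and> w j = None} i \<mapsto> u i + 1)"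

definition phase2_step ::
  "nat \<Rightarrow> nat set \<Rightarrow> (nat \<Rightarrow> nat) \<Rightarrow> nat \<Rightarrow> (nat \<rightharpoonup> nat) \<Rightarrow> (nat \<rightharpoonup> nat)" where
  "phase2_step n q u i w = w(first_right n {j \<in> {1..n}. j \<in> q \<and> w j = None} i \<mapsto> u i)"

definition queue_fill ::
  "nat \<Rightarrow> nat set \<Rightarrow> (nat \<Rightarrow> nat) \<Rightarrow> nat list \<Rightarrow> (nat \<rightharpoonup> nat)" where
  "queue_fill n q u is =
     fold (phase2_step n q u) (take (card q) is)
       (fold (phase1_step n q u) (rev (drop (card q) is)) Map.empty)"

definition sorting_order :: "nat \<Rightarrow> (nat \<Rightarrow> nat) \<Rightarrow> nat list \<Rightarrow> bool" where
  "sorting_order n u is \<longleftrightarrow> distinct is \<and> set is = {1..n} \<and> sorted (map u is)"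

definition queue_act :: "nat \<Rightarrow> nat set \<Rightarrow> (nat \<Rightarrow> nat) \<Rightarrow> (nat \<Rightarrow> nat)" where
  "queue_act n q u = (\<lambda>j. the (queue_fill n q u (SOME is. sorting_order n u is) j))"

text \<open>
  The length parameter \<open>l\<close> is explicit: \<open>m l = 0\<close> is allowed, and then the queues
  after the last nonzero entry of \<open>m\<close> are all equal to \<open>{1..n}\<close>.
\<close>

definition is_mlq :: "nat \<Rightarrow> nat \<Rightarrow> (nat \<Rightarrow> nat) \<Rightarrow> nat set list \<Rightarrow> bool" where
  "is_mlq n l m qs \<longleftrightarrow>
     psum m l = n \<and> (\<forall>i > l. m i = 0) \<and> length qs = l - 1 \<and>
     (\<forall>i \<in> {1..l - 1}. qs ! (i - 1) \<subseteq> {1..n} \<and> card (qs ! (i - 1)) = psum m i)"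

definition mlq_act :: "nat \<Rightarrow> nat set list \<Rightarrow> (nat \<Rightarrow> nat) \<Rightarrow> (nat \<Rightarrow> nat)" where
  "mlq_act n qs u = fold (queue_act n) qs u"

definition mlq_weight :: "(nat \<Rightarrow> 'a::comm_ring_1) \<Rightarrow> nat set list \<Rightarrow> 'a" where
  "mlq_weight x qs = prod_list (map (\<lambda>q. \<Prod>j\<in>q. x j) qs)"

text \<open>If \<open>l\<close> is the largest letter of the packed word \<open>u\<close>, this is the spectral weight of \<open>u\<close>.\<close>

definition spectral_weight ::
  "(nat \<Rightarrow> 'a::comm_ring_1) \<Rightarrow> nat \<Rightarrow> nat \<Rightarrow> (nat \<Rightarrow> nat) \<Rightarrow> 'a" where
  "spectral_weight x n l u =
     (\<Sum>qs | is_mlq n l (letter_count n u) qs \<and>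
            (\<forall>i \<in> {1..n}. mlq_act n qs (\<lambda>_. 1) i = u i).
        mlq_weight x qs)"

text \<open>\<open>complete_hom x k m\<close> is \<open>h\<^sub>k(x\<^sub>1, \<dots>, x\<^sub>m)\<close>; multisets index the monomials.\<close>

definition complete_hom :: "(nat \<Rightarrow> 'a::comm_ring_1) \<Rightarrow> int \<Rightarrow> nat \<Rightarrow> 'a" where
  "complete_hom x k m =
     (if k < 0 then 0
      else \<Sum>M | size M = nat k \<and> set_mset M \<subseteq> {1..m}. \<Prod>i\<in>#M. x i)"

text \<open>Polynomials over the integers: finitely supported maps from exponent vectors to coefficients.\<close>

type_synonym int_mpoly = "(nat \<Rightarrow>\<^sub>0 nat) \<Rightarrow>\<^sub>0 int"

definition indet :: "nat \<Rightarrow> int_mpoly" where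
  "indet i = Poly_Mapping.single (Poly_Mapping.single i 1) 1"

end

theory Submission
  imports Defs
begin

text \<open>
  The last queue of a multiline queue producing \<open>u(v)\<close> is \<open>B\<close>, since it carries the letters below
  \<open>\<ell>\<close>. As the letters decrease along \<open>B\<close> and the smallest ones are placed first, no letter can wrap
  around the cycle or jump over a site destined for a larger letter. Therefore the word before the
  last queue is again decreasing, supported on sites \<open>c\<^sub>1 < c\<^sub>2 < \<dots>\<close> with \<open>c\<^sub>j \<le> b\<^sub>k\<^sub>+\<^sub>j\<close> (where \<open>k\<close> is the
  multiplicity of \<open>\<ell> - 1\<close>), and \<open>c\<^sub>j > b\<^sub>k\<^sub>+\<^sub>j\<^sub>-\<^sub>1\<close> whenever \<open>v\<close> drops at position \<open>k + j\<close>. This gives a recursion in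
  \<open>\<ell>\<close> for the spectral weight. The determinant satisfies the same recursion, by
  \<open>h\<^sub>t(x\<^sub>1, \<dots>, x\<^sub>b) - h\<^sub>t(x\<^sub>1, \<dots>, x\<^sub>a) = \<Sum> x\<^sub>c h\<^sub>t\<^sub>-\<^sub>1(x\<^sub>1, \<dots>, x\<^sub>c)\<close>, summed over \<open>a < c \<le> b\<close>, and column operations.
\<close>

section \<open>Complete homogeneous polynomials and determinants\<close>

text \<open>The copies of \<open>\<ell> - 1\<close> before the last queue escape control: in Phase
  II they park after all smaller letters and may wrap, and the surplus ones become
  \<open>\<ell>\<close> in Phase I. Hence the recursion records only the sites of the smaller
  letters and treats all other sites as a default. The smaller letters are controlled because the
  leftmost site of \<open>B\<close> is destined for the largest letter \<open>\<ell> - 1\<close>: it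
  must still be free while they park, and a letter going around the cycle would take it.

  Equal letters may be processed in any order, so no fixed assignment of letters to sites can be
  followed. From queue to chain, the bounds come from counting with an arbitrary letter-preserving
  matching; from chain to queue, only counts of letters and free sites beyond a threshold are
  maintained.

  That every letter below \<open>\<ell>\<close> occurs makes \<open>v\<close> drop by exactly one at
  each drop, so that the two neighbouring columns have equal degrees and their difference
  telescopes. The size falls from \<open>r\<close> to \<open>r - k\<close> because the first
  \<open>k\<close> columns have \<open>\<gamma>\<^sub>j = 1\<close> and produce a unitriangular
  block.\<close>

lemma complete_hom_neg: "k < 0 \<Longrightarrow> complete_hom x k m = 0"
  by (simp add: complete_hom_def)

lemma complete_hom_0: "complete_hom x 0 m = 1"
proof -
  have "{M. size M = nat 0 \<and> set_mset M \<subseteq> {1..m}} = {{#}}"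
    by auto
  then show ?thesis
    by (simp add: complete_hom_def)
qed

text \<open>Split the monomials by whether \<open>x (Suc m)\<close> divides them. With the value 0
  in negative degrees this holds for every integer \<open>k\<close>, as the determinant entries
  require.\<close>

lemma complete_hom_Suc:
  "complete_hom x k (Suc m) = complete_hom x k m + x (Suc m) * complete_hom x (k - 1) (Suc m)"
proof (cases "k \<le> 0")
  case True
  then consider "k < 0" | "k = 0" by linarith
  then show ?thesis
    by cases (simp_all add: complete_hom_neg complete_hom_0)
next
  case False
  define p where "p = nat (k - 1)"
  have p: "nat k = Suc p" "nat (k - 1) = p"
    using False by (auto simp: p_def)
  let ?M = "\<lambda>s m. {M. size M = s \<and> set_mset M \<subseteq> {1..m::nat}}"
  have split: "?M (Suc p) (Suc m) = ?M (Suc p) m \<union> add_mset (Suc m) ` ?M p (Suc m)"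
  proof (intro equalityI subsetI)
    fix M assume M: "M \<in> ?M (Suc p) (Suc m)"
    show "M \<in> ?M (Suc p) m \<union> add_mset (Suc m) ` ?M p (Suc m)"
    proof (cases "Suc m \<in># M")
      case True
      then obtain N where "M = add_mset (Suc m) N"
        by (meson mset_add)
      then show ?thesis using M by auto
    next
      case False
      have "set_mset M \<subseteq> {1..m}"
      proof
        fix i assume i: "i \<in> set_mset M"
        with M have "i \<in> {1..Suc m}" by blast
        moreover have "i \<noteq> Suc m" using i False by blast
        ultimately show "i \<in> {1..m}" by simp
      qed
      then show ?thesis using M by blast
    qed
  next
    fix M assume "M \<in> ?M (Suc p) m \<union> add_mset (Suc m) ` ?M p (Suc m)"
    then show "M \<in> ?M (Suc p) (Suc m)"
      by auto
  qed
  have fin: "finite (?M s m)" for s m :: nat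
  proof -
    have "?M s m = multisets_of_size {1..m} s"
      by (auto simp: multisets_of_size_def)
    then show ?thesis by (simp add: finite_multisets_of_size)
  qed
  have disj: "?M (Suc p) m \<inter> add_mset (Suc m) ` ?M p (Suc m) = {}"
    by auto
  have "complete_hom x k (Suc m) = (\<Sum>M\<in>?M (Suc p) (Suc m). \<Prod>i\<in>#M. x i)"
    using False p by (simp add: complete_hom_def)
  also have "\<dots> = (\<Sum>M\<in>?M (Suc p) m. \<Prod>i\<in>#M. x i) + (\<Sum>M\<in>add_mset (Suc m) ` ?M p (Suc m). \<Prod>i\<in>#M. x i)"
    unfolding split by (rule sum.union_disjoint[OF fin finite_imageI[OF fin] disj])
  also have "(\<Sum>M\<in>add_mset (Suc m) ` ?M p (Suc m). \<Prod>i\<in>#M. x i) =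
      x (Suc m) * (\<Sum>M\<in>?M p (Suc m). \<Prod>i\<in>#M. x i)"
    by (subst sum.reindex) (auto simp: inj_on_def sum_distrib_left)
  finally show ?thesis
    using False p by (simp add: complete_hom_def)
qed

lemma complete_hom_telescope:
  assumes "a \<le> b"
  shows "complete_hom x k b - complete_hom x k a = (\<Sum>c\<in>{a<..b}. x c * complete_hom x (k - 1) c)"
  using assms
proof (induction b rule: dec_induct)
  case (step b)
  then have "{a<..Suc b} = insert (Suc b) {a<..b}" by auto
  with step show ?case
    by (simp add: complete_hom_Suc[of x k b])
qed simp

text \<open>The first argument of \<open>g\<close> is the column, so that a column operation is a
  function update \<open>g(j := f)\<close>.\<close>

definition cdet :: "nat \<Rightarrow> (nat \<Rightarrow> nat \<Rightarrow> 'a::comm_ring_1) \<Rightarrow> 'a" where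
  "cdet r g = det (mat r r (\<lambda>(i, j). g j i))"

lemma cdet_cong:
  assumes "\<And>i j. i < r \<Longrightarrow> j < r \<Longrightarrow> g j i = h j i"
  shows "cdet r g = cdet r h"
proof -
  have "mat r r (\<lambda>(i, j). g j i) = mat r r (\<lambda>(i, j). h j i)"
    by (rule eq_matI) (auto simp: assms)
  then show ?thesis by (simp add: cdet_def)
qed

lemma cdet_linear:
  assumes "j < r"
  shows "cdet r (g(j := \<lambda>i. \<Sum>c\<in>S. a c * h c i)) = (\<Sum>c\<in>S. a c * cdet r (g(j := h c)))"
proof -
  let ?M = "\<lambda>f. mat r r (\<lambda>(i, j'). (g(j := f)) j' i)"
  \<comment> \<open>The cofactors along column \<open>j\<close> do not see that column and may be
    computed with 0 in it. This exhibits the determinant as a linear form in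
    \<open>f\<close>.\<close>
  have expand: "cdet r (g(j := f)) = (\<Sum>i<r. f i * cofactor (?M (\<lambda>_. 0)) i j)" for f
  proof -
    have "cofactor (?M f) i j = cofactor (?M (\<lambda>_. 0)) i j" if "i < r" for i
    proof -
      have "mat_delete (?M f) i j = mat_delete (?M (\<lambda>_. 0)) i j"
        using assms that by (intro eq_matI) (auto simp: mat_delete_def)
      then show ?thesis by (simp add: cofactor_def)
    qed
    moreover have "det (?M f) = (\<Sum>i<r. ?M f $$ (i, j) * cofactor (?M f) i j)"
      by (rule laplace_expansion_column) (use assms in auto)
    ultimately show ?thesis
      using assms by (simp add: cdet_def)
  qed
  show ?thesis
    unfolding expand sum_distrib_left sum_distrib_right
    by (subst sum.swap) (simp add: mult.assoc)
qed

lemma cdet_identical: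
  assumes "i < r" "j < r" "i \<noteq> j" "g i = g j"
  shows "cdet r g = 0"
  unfolding cdet_def
  by (rule det_identical_columns[of _ r i j]) (use assms in \<open>auto intro!: eq_vecI\<close>)

lemma cdet_diff:
  assumes "j < r"
  shows "cdet r (g(j := \<lambda>i. f i - h i)) = cdet r (g(j := f)) - cdet r (g(j := h))"
  \<comment> \<open>A difference is a sum over two indices with coefficients 1 and -1.\<close>
  using cdet_linear[OF assms, where g = g and S = "{True, False}" and
      a = "\<lambda>c. if c then 1 else - 1" and h = "\<lambda>c. if c then f else h"]
  by simp

lemma cdet_sub_column:
  assumes "i < r" "j < r" "i \<noteq> j"
  shows "cdet r (g(j := \<lambda>m. g j m - g i m)) = cdet r g"
proof -
  have "cdet r (g(j := g i)) = 0"
    by (rule cdet_identical[of i _ j]) (use assms in auto)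
  then show ?thesis
    using assms by (simp add: cdet_diff)
qed

lemma cdet_sub_previous:
  assumes "0 \<notin> T"
  shows "cdet r (\<lambda>j. if j \<in> T then (\<lambda>i. g j i - g (j - 1) i) else g j) = cdet r g"
proof -
  \<comment> \<open>The subtractions are carried out from right to left, so that the subtracted
    column is always still an original one. In \<open>G t\<close> the columns from \<open>t\<close>
    on are done.\<close>
  define G where "G t = (\<lambda>j. if t \<le> j \<and> j \<in> T then (\<lambda>i. g j i - g (j - 1) i) else g j)" for t
  have "cdet r (G t) = cdet r (G (Suc t))" if "t < r" for t
  proof (cases "t \<in> T")
    case True
    then have "t \<noteq> 0" using assms by metis
    have "G t = (G (Suc t))(t := \<lambda>m. G (Suc t) t m - G (Suc t) (t - 1) m)"
      using True \<open>t \<noteq> 0\<close> by (auto simp: G_def fun_eq_iff le_Suc_eq)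
    then show ?thesis
      using cdet_sub_column[of "t - 1" r t "G (Suc t)"] that \<open>t \<noteq> 0\<close> by simp
  next
    case False
    then have "G t = G (Suc t)"
      by (auto simp: G_def fun_eq_iff) (metis le_antisym not_less_eq_eq)+
    then show ?thesis by simp
  qed
  then have "cdet r (G t) = cdet r (G 0)" if "t \<le> r" for t
    using that by (induction t) auto
  from this[of r] have "cdet r (G 0) = cdet r (G r)" by (rule sym) simp
  moreover have "cdet r (G r) = cdet r g"
    by (rule cdet_cong) (simp add: G_def)
  ultimately show ?thesis by (simp add: G_def)
qed

lemma cdet_Suc:
  assumes "g 0 0 = 1" "\<And>j. 0 < j \<Longrightarrow> j < Suc r \<Longrightarrow> g j 0 = 0"
  shows "cdet (Suc r) g = cdet r (\<lambda>j i. g (Suc j) (Suc i))"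
proof -
  let ?A = "mat (Suc r) (Suc r) (\<lambda>(i, j). g j i)"
  have "cdet (Suc r) g = (\<Sum>j<Suc r. ?A $$ (0, j) * cofactor ?A 0 j)"
    unfolding cdet_def by (rule laplace_expansion_row) auto
  also have "\<dots> = cofactor ?A 0 0"
    using assms by (subst sum.lessThan_Suc_shift) simp
  also have "mat_delete ?A 0 0 = mat r r (\<lambda>(i, j). g (Suc j) (Suc i))"
    by (rule eq_matI) (auto simp: mat_delete_def)
  then have "cofactor ?A 0 0 = cdet r (\<lambda>j i. g (Suc j) (Suc i))"
    by (simp add: cofactor_def cdet_def)
  finally show ?thesis .
qed

text \<open>Expanding along the top row \<open>k\<close> times removes a leading block with ones on
  the diagonal and zeros to the right of it; the entries below the diagonal are arbitrary.\<close>

lemma cdet_unitriangular_block: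
  assumes "\<And>j. j < k \<Longrightarrow> g j j = 1"
    and "\<And>i j. i < j \<Longrightarrow> i < k \<Longrightarrow> j < k + s \<Longrightarrow> g j i = 0"
  shows "cdet (k + s) g = cdet s (\<lambda>j i. g (k + j) (k + i))"
  using assms
proof (induction k arbitrary: g)
  case (Suc k)
  have "cdet (Suc k + s) g = cdet (k + s) (\<lambda>j i. g (Suc j) (Suc i))"
    using Suc.prems by (simp add: cdet_Suc)
  also have "\<dots> = cdet s (\<lambda>j i. g (Suc k + j) (Suc k + i))"
    by (subst Suc.IH) (use Suc.prems in auto)
  finally show ?case .
qed simp

section \<open>The determinant recursion\<close>

text \<open>A column of Jacobi-Trudi shape: \<open>t\<close> is the degree of the top entry. Two
  columns with the same \<open>t\<close> differ only in the number of variables, so their difference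
  telescopes in all rows at once.\<close>

definition hcol :: "(nat \<Rightarrow> 'a::comm_ring_1) \<Rightarrow> int \<Rightarrow> nat \<Rightarrow> nat \<Rightarrow> 'a" where
  "hcol x t c = (\<lambda>i. complete_hom x (t + int i) c)"

lemma hcol_telescope:
  assumes "a \<le> b"
  shows "hcol x t b i - hcol x t a i = (\<Sum>c\<in>{a<..b}. x c * hcol x (t - 1) c i)"
  using complete_hom_telescope[OF assms, of x "t + int i"] by (simp add: hcol_def algebra_simps)

text \<open>Positions in the lists start at 0, and \<open>k\<close> is the multiplicity of the
  largest letter \<open>l - 1\<close>. Its positivity forces \<open>2 \<le> l\<close>; the case
  \<open>l = 1\<close> is the base of the final induction.\<close>

locale decreasing_word =
  fixes n l k :: nat and bs vs :: "nat list"
  assumes sorted_bs: "sorted_wrt (<) bs"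
    and bs_sites: "set bs \<subseteq> {1..n}"
    and length_vs: "length vs = length bs"
    and vs_decreasing: "sorted_wrt (\<ge>) vs"
    and set_vs: "set vs = {1..l - 1}"
    and k_pos: "0 < k"
    and k_le: "k \<le> length bs"
    and vs_top: "\<And>j. j < k \<Longrightarrow> vs ! j = l - 1"
    and vs_low: "\<And>j. k \<le> j \<Longrightarrow> j < length bs \<Longrightarrow> vs ! j < l - 1"
begin

text \<open>
  A chain lists the sites of the last queue but one, in increasing order. Such a queue yields the
  given word exactly if each of its letters reaches its final position without wrapping around and
  without passing a site reserved for a larger letter.
\<close>

definition lower :: "nat list \<Rightarrow> nat \<Rightarrow> nat" where
  "lower cs j = (if vs ! (k + j) = vs ! (k + j - 1) then cs ! (j - 1) else bs ! (k + j - 1))"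

definition chains :: "nat \<Rightarrow> nat list set" where
  "chains t = {cs. length cs = t \<and> (\<forall>j<t. lower cs j < cs ! j \<and> cs ! j \<le> bs ! (k + j))}"

lemma bs_mono: "i < j \<Longrightarrow> j < length bs \<Longrightarrow> bs ! i < bs ! j"
  using sorted_bs by (simp add: sorted_wrt_iff_nth_less)

lemma bs_mono_le: "i \<le> j \<Longrightarrow> j < length bs \<Longrightarrow> bs ! i \<le> bs ! j"
  using bs_mono[of i j] by (cases "i = j") auto

lemma vs_anti: "i \<le> j \<Longrightarrow> j < length bs \<Longrightarrow> vs ! j \<le> vs ! i"
  using vs_decreasing length_vs by (cases "i = j") (auto simp: sorted_wrt_iff_nth_less)

lemma vs_bounds:
  assumes "j < length bs"
  shows "1 \<le> vs ! j" "vs ! j \<le> l - 1"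
  using set_vs assms nth_mem[of j vs] length_vs by auto

lemma l_ge_2: "2 \<le> l"
proof -
  have "0 < length bs" using k_pos k_le by linarith
  from vs_bounds[OF this] show ?thesis by simp
qed

text \<open>All letters from 1 to \<open>l - 1\<close> occur, and a skipped letter would have no
  place in a decreasing list.\<close>

lemma vs_step:
  assumes "0 < j" "j < length bs"
  shows "vs ! (j - 1) \<le> vs ! j + 1"
proof (rule ccontr)
  assume *: "\<not> ?thesis"
  have "vs ! (j - 1) \<le> l - 1"
    using assms by (intro vs_bounds) simp
  then have "vs ! j + 1 \<in> set vs"
    using * by (simp add: set_vs)
  then obtain i where i: "i < length bs" "vs ! i = vs ! j + 1"
    by (metis in_set_conv_nth length_vs)
  have "i \<le> j - 1 \<or> j \<le> i" by linarith
  then show False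
  proof
    assume "i \<le> j - 1"
    then have "vs ! (j - 1) \<le> vs ! i" using assms by (intro vs_anti) auto
    then show False using * i by simp
  next
    assume "j \<le> i"
    then show False using i vs_anti[of j i] by simp
  qed
qed

lemma vs_start:
  assumes "0 < j" "j < length bs" "vs ! j \<noteq> vs ! (j - 1)"
  shows "vs ! (j - 1) = vs ! j + 1"
  using vs_step[OF assms(1,2)] vs_anti[of "j - 1" j] assms by simp

lemma vs_k: "k < length bs \<Longrightarrow> vs ! k \<noteq> vs ! (k - 1)"
  using vs_top[of "k - 1"] vs_low[of k] k_pos by simp

text \<open>Letters start from \<open>l - 2\<close> at position \<open>k\<close> and drop by at most
  one per step. This bound makes the degrees negative in the top \<open>k\<close> rows of the later
  columns.\<close>

lemma vs_codepth:
  assumes "k \<le> j" "j < length bs"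
  shows "l \<le> vs ! j + (j - k) + 2"
  using assms
proof (induction j rule: dec_induct)
  case base
  then show ?case using vs_start[OF k_pos] vs_k vs_top[of "k - 1"] k_pos by simp
next
  case (step j)
  then show ?case using vs_step[of "Suc j"] by simp
qed

section \<open>Enumeration of chains one site at a time\<close>

lemma finite_chains:
  assumes "t \<le> length bs - k"
  shows "finite (chains t)"
proof (rule finite_subset)
  have "c \<le> n" if cs: "cs \<in> chains t" and c: "c \<in> set cs" for c cs
  proof -
    obtain j where j: "j < t" "c = cs ! j"
      using c cs by (auto simp: chains_def in_set_conv_nth)
    then have "c \<le> bs ! (k + j)" using cs by (simp add: chains_def)
    moreover have "bs ! (k + j) \<in> set bs" using j assms by simp
    ultimately show ?thesis using bs_sites by fastforce
  qed
  then show "chains t \<subseteq> {cs. set cs \<subseteq> {..n} \<and> length cs = t}"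
    by (auto simp: chains_def)
  show "finite {cs. set cs \<subseteq> {..n} \<and> length cs = t}"
    by (rule finite_lists_length_eq) simp
qed

text \<open>For \<open>j = 0\<close> the entry \<open>cs ! (j - 1)\<close> would have no meaning,
  but \<open>v\<close> drops at position \<open>k\<close>, so \<open>lower\<close> uses a site of
  \<open>bs\<close> there.\<close>

lemma lower_append:
  assumes "j < length bs - k" "j \<le> length cs"
  shows "lower (cs @ ds) j = lower cs j"
  using assms vs_k by (cases j) (auto simp: lower_def nth_append)

lemma sum_chains_Suc:
  assumes t: "t < length bs - k"
  shows "sum f (chains (Suc t)) =
    (\<Sum>cs\<in>chains t. \<Sum>c\<in>{lower cs t<..bs ! (k + t)}. f (cs @ [c]))"
proof -
  have "bij_betw (\<lambda>(cs, c). cs @ [c]) (SIGMA cs:chains t. {lower cs t<..bs ! (k + t)}) (chains (Suc t))"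
    unfolding bij_betw_def
  proof (intro conjI equalityI subsetI)
    fix ds assume "ds \<in> (\<lambda>(cs, c). cs @ [c]) ` (SIGMA cs:chains t. {lower cs t<..bs ! (k + t)})"
    then obtain cs c where ds: "ds = cs @ [c]" "cs \<in> chains t" "lower cs t < c" "c \<le> bs ! (k + t)"
      by auto
    then show "ds \<in> chains (Suc t)"
      using t by (auto simp: chains_def lower_append less_Suc_eq nth_append)
  next
    fix ds assume ds: "ds \<in> chains (Suc t)"
    then obtain cs c where [simp]: "ds = cs @ [c]" "length cs = t"
      by (auto simp: chains_def length_Suc_conv_rev)
    have *: "lower cs j < ds ! j \<and> ds ! j \<le> bs ! (k + j)" if "j \<le> t" for j
    proof -
      have "lower (cs @ [c]) j = lower cs j"
        using that t by (intro lower_append) auto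
      then show ?thesis
        using ds that unfolding chains_def by (metis (mono_tags, lifting) \<open>ds = cs @ [c]\<close> le_imp_less_Suc mem_Collect_eq)
    qed
    have "cs \<in> chains t"
      unfolding chains_def
    proof (intro CollectI conjI allI impI)
      fix j assume "j < t"
      then show "lower cs j < cs ! j" "cs ! j \<le> bs ! (k + j)"
        using *[of j] by (simp_all add: nth_append)
    qed simp
    moreover have "lower cs t < c" "c \<le> bs ! (k + t)"
      using *[of t] by (simp_all add: nth_append)
    ultimately show "ds \<in> (\<lambda>(cs, c). cs @ [c]) ` (SIGMA cs:chains t. {lower cs t<..bs ! (k + t)})"
      by force
  qed (auto simp: inj_on_def)
  from sum.reindex_bij_betw[OF this, of f] show ?thesis
    using finite_chains[of t] t by (subst sum.Sigma) (auto simp: case_prod_unfold)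
qed

section \<open>Column operations on the determinant\<close>

context
  fixes x :: "nat \<Rightarrow> 'a::comm_ring_1"
begin

text \<open>
  At a block start, subtracting the previous column of the determinant telescopes into a sum over
  the sites between the two; inside a block, column \<open>j\<close> becomes a sum over the sites beyond
  \<open>cs ! (j - 1)\<close> after subtracting column \<open>j - 1\<close>, which has already been replaced. Hence \<open>stage\<close>
  replaces the columns from left to right, starting from the differences \<open>scol\<close>.
\<close>

definition bcol :: "nat \<Rightarrow> nat \<Rightarrow> 'a" where
  "bcol j = hcol x (int l - int (vs ! j) - int j - 1) (bs ! j)"

text \<open>The degree is one less than in \<open>bcol\<close>, since telescoping takes out the
  factor \<open>x c\<close>.\<close>

definition ccol :: "nat \<Rightarrow> nat \<Rightarrow> nat \<Rightarrow> 'a" where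
  "ccol j c = hcol x (int l - int (vs ! j) - int j - 2) c"

definition block_starts :: "nat set" where
  "block_starts = {j. k \<le> j \<and> j < length bs \<and> vs ! j \<noteq> vs ! (j - 1)}"

definition scol :: "nat \<Rightarrow> nat \<Rightarrow> 'a" where
  "scol j = (if j \<in> block_starts then (\<lambda>i. bcol j i - bcol (j - 1) i) else bcol j)"

definition stage :: "nat \<Rightarrow> nat list \<Rightarrow> nat \<Rightarrow> nat \<Rightarrow> 'a" where
  "stage t cs j = (if j < k then bcol j else if j < k + t then ccol j (cs ! (j - k)) else scol j)"

text \<open>At a block start the letter drops by one while the index grows by one. So
  \<open>vs ! j + j\<close> is unchanged, and columns \<open>j - 1\<close> and \<open>j\<close> have
  the same degrees.\<close>

lemma scol_start:
  assumes "j \<in> block_starts"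
  shows "scol j = (\<lambda>i. \<Sum>c\<in>{bs ! (j - 1)<..bs ! j}. x c * ccol j c i)"
proof
  fix i
  have j: "0 < j" "j < length bs" "vs ! (j - 1) = vs ! j + 1"
    using assms k_pos vs_start[of j] by (auto simp: block_starts_def)
  have e: "int l - int (vs ! (j - 1)) - int (j - 1) - 1 = int l - int (vs ! j) - int j - 1"
    using j by simp
  have "scol j i = hcol x (int l - int (vs ! j) - int j - 1) (bs ! j) i -
      hcol x (int l - int (vs ! j) - int j - 1) (bs ! (j - 1)) i"
    by (simp only: scol_def bcol_def assms if_True e)
  also have "\<dots> = (\<Sum>c\<in>{bs ! (j - 1)<..bs ! j}. x c * ccol j c i)"
    using bs_mono_le[of "j - 1" j] j by (subst hcol_telescope) (auto simp: ccol_def algebra_simps)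
  finally show "scol j i = (\<Sum>c\<in>{bs ! (j - 1)<..bs ! j}. x c * ccol j c i)" .
qed

lemma stage_step:
  assumes t: "t < length bs - k" and cs: "cs \<in> chains t"
  shows "cdet (length bs) (stage t cs) =
    (\<Sum>c\<in>{lower cs t<..bs ! (k + t)}. x c * cdet (length bs) (stage (Suc t) (cs @ [c])))"
proof -
  let ?j = "k + t"
  have j: "?j < length bs" "0 < ?j" using t k_pos by auto
  have len: "length cs = t" using cs by (simp add: chains_def)
  have upd: "(stage t cs)(?j := ccol ?j c) = stage (Suc t) (cs @ [c])" for c
  proof
    fix j
    consider "j < k" | "k \<le> j" "j < k + t" | "j = k + t" | "k + t < j" by linarith
    then show "((stage t cs)(?j := ccol ?j c)) j = stage (Suc t) (cs @ [c]) j"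
      by cases (auto simp: stage_def nth_append len)
  qed
  have "cdet (length bs) (stage t cs) = cdet (length bs)
      ((stage t cs)(?j := (\<lambda>i. \<Sum>c\<in>{lower cs t<..bs ! ?j}. x c * ccol ?j c i)))"
  proof (cases "vs ! ?j = vs ! (?j - 1)")
    case False
    then have "?j \<in> block_starts" using j by (simp add: block_starts_def)
    then have "stage t cs ?j = (\<lambda>i. \<Sum>c\<in>{lower cs t<..bs ! ?j}. x c * ccol ?j c i)"
      using False by (simp add: stage_def scol_start lower_def)
    then show ?thesis by (metis fun_upd_triv)
  next
    case True
    then have "t \<noteq> 0" using vs_k j by (cases "t = 0") auto
    let ?c = "cs ! (t - 1)"
    have low: "lower cs t = ?c" using True by (simp add: lower_def)
    have "t - 1 < t" using \<open>t \<noteq> 0\<close> by simp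
    then have "?c \<le> bs ! (k + (t - 1))" using cs unfolding chains_def by blast
    also have "\<dots> \<le> bs ! ?j" using j by (intro bs_mono_le) auto
    finally have le: "?c \<le> bs ! ?j" .
    \<comment> \<open>Inside a block the smaller index gives column \<open>j - 1\<close> one degree
      more, which is offset by the degree lost with the extracted factor. It therefore matches the
      degrees of the untouched column \<open>j\<close>.\<close>
    have prev: "stage t cs (?j - 1) = hcol x (int l - int (vs ! ?j) - int ?j - 1) ?c"
    proof -
      have "int l - int (vs ! (?j - 1)) - int (?j - 1) - 2 = int l - int (vs ! ?j) - int ?j - 1"
        using True j by linarith
      then have "ccol (?j - 1) ?c = hcol x (int l - int (vs ! ?j) - int ?j - 1) ?c"
        unfolding ccol_def by metis
      moreover have "stage t cs (?j - 1) = ccol (?j - 1) ?c"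
        using \<open>t \<noteq> 0\<close> by (auto simp: stage_def)
      ultimately show ?thesis by simp
    qed
    have cur: "stage t cs ?j = hcol x (int l - int (vs ! ?j) - int ?j - 1) (bs ! ?j)"
      using True by (simp add: stage_def scol_def block_starts_def bcol_def)
    have "(\<lambda>i. stage t cs ?j i - stage t cs (?j - 1) i) =
        (\<lambda>i. \<Sum>c\<in>{lower cs t<..bs ! ?j}. x c * ccol ?j c i)"
      unfolding prev cur low ccol_def using hcol_telescope[OF le, of x] by (simp add: algebra_simps)
    moreover have "?j - 1 < length bs" "?j - 1 \<noteq> ?j" using j by linarith+
    ultimately show ?thesis
      using cdet_sub_column[of "?j - 1" "length bs" ?j "stage t cs"] j by simp
  qed
  also have "\<dots> = (\<Sum>c\<in>{lower cs t<..bs ! ?j}. x c * cdet (length bs) (stage (Suc t) (cs @ [c])))"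
    using j by (simp add: cdet_linear upd)
  finally show ?thesis .
qed

lemma cdet_expand_chains:
  assumes "t \<le> length bs - k"
  shows "cdet (length bs) bcol = (\<Sum>cs\<in>chains t. prod_list (map x cs) * cdet (length bs) (stage t cs))"
  using assms
proof (induction t)
  case 0
  have "cdet (length bs) bcol = cdet (length bs) scol"
    unfolding scol_def
    by (rule cdet_sub_previous[symmetric]) (use k_pos in \<open>simp add: block_starts_def\<close>)
  moreover have "stage 0 [] = scol"
    by (auto simp: stage_def scol_def block_starts_def fun_eq_iff)
  moreover have "chains 0 = {[]}"
    by (auto simp: chains_def)
  ultimately show ?case by simp
next
  case (Suc t)
  have "(\<Sum>cs\<in>chains t. prod_list (map x cs) * cdet (length bs) (stage t cs)) =
      (\<Sum>cs\<in>chains t. \<Sum>c\<in>{lower cs t<..bs ! (k + t)}.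
        prod_list (map x (cs @ [c])) * cdet (length bs) (stage (Suc t) (cs @ [c])))"
    using Suc.prems by (intro sum.cong) (simp_all add: stage_step sum_distrib_left mult.assoc)
  also have "\<dots> = (\<Sum>cs\<in>chains (Suc t). prod_list (map x cs) * cdet (length bs) (stage (Suc t) cs))"
    using Suc.prems by (intro sum_chains_Suc[symmetric]) simp
  finally show ?case using Suc by simp
qed

text \<open>For \<open>j < k\<close> the letter is \<open>l - 1\<close>, so entry
  \<open>(i, j)\<close> is the complete homogeneous polynomial of degree \<open>i - j\<close>: 1 on
  the diagonal and 0 above it. In the later columns \<open>vs_codepth\<close> makes the first
  \<open>k\<close> rows vanish. What remains belongs to the shorter word with largest letter
  \<open>l - 2\<close>.\<close>

lemma cdet_stage:
  "cdet (length bs) (stage (length bs - k) cs) =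
    cdet (length bs - k)
      (\<lambda>j. hcol x (int (l - 1) - int (drop k vs ! j) - int j - 1) (cs ! j))"
proof -
  let ?s = "length bs - k"
  have "cdet (k + ?s) (stage ?s cs) = cdet ?s (\<lambda>j i. stage ?s cs (k + j) (k + i))"
  proof (rule cdet_unitriangular_block)
    fix j assume "j < k"
    then show "stage ?s cs j j = 1"
      using l_ge_2 by (simp add: stage_def bcol_def hcol_def vs_top of_nat_diff complete_hom_0)
  next
    fix i j assume ij: "i < j" "i < k" "j < k + ?s"
    show "stage ?s cs j i = 0"
    proof (cases "j < k")
      case True
      then show ?thesis
        using l_ge_2 ij by (simp add: stage_def bcol_def hcol_def vs_top of_nat_diff complete_hom_neg)
    next
      case False
      moreover have "j < length bs" using ij k_le by simp
      moreover have "int l - int (vs ! j) - int j - 2 + int i < 0"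
        using vs_codepth[of j] False ij \<open>j < length bs\<close> by linarith
      ultimately show ?thesis
        using ij by (simp add: stage_def ccol_def hcol_def complete_hom_neg)
    qed
  qed
  also have "\<dots> = cdet ?s
      (\<lambda>j. hcol x (int (l - 1) - int (drop k vs ! j) - int j - 1) (cs ! j))"
  proof (rule cdet_cong)
    fix i j assume "i < ?s" "j < ?s"
    then have j: "k + j < k + ?s" "k + j < length bs" by auto
    \<comment> \<open>The shifts of row and column by \<open>k\<close> cancel, and one unit of the 2
      is absorbed in passing from \<open>l\<close> to \<open>l - 1\<close>.\<close>
    have e: "int l - int (vs ! (k + j)) - int (k + j) - 2 + int (k + i) =
        int (l - 1) - int (drop k vs ! j) - int j - 1 + int i"
      using l_ge_2 k_le length_vs by (simp add: of_nat_diff)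
    have "stage ?s cs (k + j) (k + i) =
        complete_hom x (int l - int (vs ! (k + j)) - int (k + j) - 2 + int (k + i)) (cs ! j)"
      using j unfolding stage_def ccol_def hcol_def by (simp del: of_nat_add)
    then show "stage ?s cs (k + j) (k + i) =
        hcol x (int (l - 1) - int (drop k vs ! j) - int j - 1) (cs ! j) i"
      by (simp only: e hcol_def)
  qed
  finally show ?thesis using k_le by simp
qed

lemma cdet_recursion:
  "cdet (length bs) (\<lambda>j. hcol x (int l - int (vs ! j) - int j - 1) (bs ! j)) =
    (\<Sum>cs\<in>chains (length bs - k). prod_list (map x cs) * cdet (length bs - k)
      (\<lambda>j. hcol x (int (l - 1) - int (drop k vs ! j) - int j - 1) (cs ! j)))"
  using cdet_expand_chains[of "length bs - k"] unfolding cdet_stage bcol_def by simp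

end

end

section \<open>Parking of letters in a queue\<close>

lemma right_of_eq:
  assumes "i \<in> {1..n}" "d < n"
  shows "right_of n i d = (if i + d \<le> n then i + d else i + d - n)"
proof (cases "i + d \<le> n")
  case True
  then show ?thesis using assms by (simp add: right_of_def)
next
  case False
  then have "(i - 1 + d) mod n = i - 1 + d - n"
    using assms by (subst le_mod_geq) auto
  then show ?thesis using False assms by (simp add: right_of_def)
qed

lemma first_right_ahead:
  assumes i: "i \<in> {1..n}" and F: "F \<subseteq> {1..n}" and ex: "\<exists>f\<in>F. i \<le> f"
  shows "first_right n F i = Min {f \<in> F. i \<le> f}"
proof -
  have fin: "finite {f \<in> F. i \<le> f}"
    using F finite_subset[of F "{1..n}"] by auto
  define m where "m = Min {f \<in> F. i \<le> f}"
  have m: "m \<in> F" "i \<le> m"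
    using Min_in[OF fin] ex by (auto simp: m_def)
  then have mn: "m \<le> n" using F by auto
  have "(LEAST d. right_of n i d \<in> F) = m - i"
  proof (rule Least_equality)
    show "right_of n i (m - i) \<in> F"
      using m mn i by (subst right_of_eq) auto
  next
    fix d assume d: "right_of n i d \<in> F"
    show "m - i \<le> d"
    proof (rule ccontr)
      assume "\<not> m - i \<le> d"
      then have "i + d < m" "d < n" using m mn by auto
      moreover from this have "i + d \<in> {f \<in> F. i \<le> f}"
        using d i mn by (auto simp: right_of_eq)
      then have "m \<le> i + d" unfolding m_def using fin by (intro Min_le)
      ultimately show False by simp
    qed
  qed
  then show ?thesis
    unfolding first_right_def using m mn i by (auto simp: right_of_eq m_def[symmetric])
qed

lemma first_right_wrap:
  assumes i: "i \<in> {1..n}" and F: "F \<subseteq> {1..n}" "F \<noteq> {}" and nex: "\<And>f. f \<in> F \<Longrightarrow> f < i"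
  shows "first_right n F i = Min F"
proof -
  have fin: "finite F"
    using F finite_subset[of F "{1..n}"] by auto
  define m where "m = Min F"
  have m: "m \<in> F" "m < i" "1 \<le> m"
    using Min_in[OF fin] F nex by (auto simp: m_def)
  have in': "i \<le> n" using i by simp
  have "(LEAST d. right_of n i d \<in> F) = n + m - i"
  proof (rule Least_equality)
    show "right_of n i (n + m - i) \<in> F"
      using m in' i by (subst right_of_eq) auto
  next
    fix d assume d: "right_of n i d \<in> F"
    show "n + m - i \<le> d"
    proof (rule ccontr)
      assume "\<not> n + m - i \<le> d"
      then have lt: "i + d < n + m" "d < n" using m in' by auto
      show False
      proof (cases "i + d \<le> n")
        case True
        then have "i + d \<in> F" using d i lt by (simp add: right_of_eq)
        then show False using nex by fastforce
      next
        case False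
        then have "i + d - n \<in> F" using d i lt by (simp add: right_of_eq)
        then have "m \<le> i + d - n" unfolding m_def using fin by (intro Min_le)
        then show False using lt False by simp
      qed
    qed
  qed
  then show ?thesis
    unfolding first_right_def using m in' i by (auto simp: right_of_eq m_def[symmetric])
qed

lemma first_right_in:
  assumes "i \<in> {1..n}" "F \<subseteq> {1..n}" "F \<noteq> {}"
  shows "first_right n F i \<in> F"
proof (cases "\<exists>f\<in>F. i \<le> f")
  case True
  have "finite {f \<in> F. i \<le> f}"
    using assms finite_subset[of F "{1..n}"] by auto
  then have "Min {f \<in> F. i \<le> f} \<in> {f \<in> F. i \<le> f}"
    using True by (intro Min_in) auto
  then show ?thesis using first_right_ahead[OF assms(1,2) True] by simp
next
  case False
  have "finite F"
    using assms finite_subset[of F "{1..n}"] by auto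
  then have "Min F \<in> F"
    using assms by (intro Min_in) auto
  then show ?thesis using first_right_wrap[OF assms] False by (simp add: not_le)
qed

lemma first_left_in:
  assumes "i \<in> {1..n}" "F \<subseteq> {1..n}" "F \<noteq> {}"
  shows "first_left n F i \<in> F"
proof -
  obtain f where f: "f \<in> F" using assms by blast
  then have fn: "1 \<le> f" "f \<le> n" using assms by auto
  \<comment> \<open>Going \<open>i + n - f\<close> steps to the left reaches \<open>f\<close>; the
    extra \<open>n\<close> keeps the number of steps nonnegative.\<close>
  have "int i - 1 - int (i + n - f) = int f - 1 - int n"
    using fn by (simp add: of_nat_diff)
  then have "(int i - 1 - int (i + n - f)) mod int n = (int f - 1) mod int n"
    by (metis minus_mod_self2)
  then have "left_of n i (i + n - f) = f"
    using fn by (simp add: left_of_def)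
  with f have "left_of n i (i + n - f) \<in> F" by simp
  then show ?thesis
    unfolding first_left_def by (rule LeastI)
qed

text \<open>Domain and range are enough: in the situation studied below, all letters placed in Phase
  I are equal, so it does not matter which of them lands where.\<close>

lemma phase1_fill:
  assumes "q \<subseteq> {1..n}" "dom f \<subseteq> {1..n} - q" "set xs \<subseteq> {1..n}"
    and "card ({1..n} - q - dom f) = length xs"
  shows "dom (fold (phase1_step n q w) xs f) = {1..n} - q \<and>
    ran (fold (phase1_step n q w) xs f) = ran f \<union> (\<lambda>i. w i + 1) ` set xs"
  using assms
proof (induction xs arbitrary: f)
  case Nil
  then show ?case by auto
next
  case (Cons i xs)
  let ?F = "{j \<in> {1..n}. j \<notin> q \<and> f j = None}"
  have F: "?F = {1..n} - q - dom f" by auto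
  then have "card ?F = Suc (length xs)" using Cons.prems by simp
  then have ne: "?F \<noteq> {}" by (metis card.empty nat.distinct(1))
  define j where "j = first_left n ?F i"
  have j: "j \<in> ?F"
    unfolding j_def by (rule first_left_in) (use Cons.prems ne in auto)
  define f' where "f' = f(j \<mapsto> w i + 1)"
  have step: "phase1_step n q w i f = f'"
    by (simp add: phase1_step_def f'_def j_def)
  have "{1..n} - q - dom f' = ?F - {j}"
    using F by (auto simp: f'_def)
  then have "card ({1..n} - q - dom f') = length xs"
    using j \<open>card ?F = Suc (length xs)\<close> by simp
  moreover have "dom f' \<subseteq> {1..n} - q"
    using Cons.prems j by (auto simp: f'_def)
  ultimately have IH: "dom (fold (phase1_step n q w) xs f') = {1..n} - q \<and>
      ran (fold (phase1_step n q w) xs f') = ran f' \<union> (\<lambda>i. w i + 1) ` set xs"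
    using Cons.prems by (intro Cons.IH) auto
  moreover have "ran f' = insert (w i + 1) (ran f)"
    using j unfolding f'_def by (intro ran_map_upd) auto
  ultimately show ?case
    by (simp add: step)
qed

lemma phase2_step_site:
  assumes "q \<subseteq> {1..n}" "i \<in> {1..n}" "card (q - dom f) = Suc m"
  defines "j \<equiv> first_right n (q - dom f) i"
  shows "phase2_step n q w i f = f(j \<mapsto> w i)" "j \<in> q - dom f"
    and "q - dom (f(j \<mapsto> w i)) = q - dom f - {j}" "card (q - dom (f(j \<mapsto> w i))) = m"
proof -
  have F: "{j \<in> {1..n}. j \<in> q \<and> f j = None} = q - dom f"
    using assms(1) by auto
  show "phase2_step n q w i f = f(j \<mapsto> w i)"
    unfolding phase2_step_def F j_def ..
  have "q - dom f \<noteq> {}"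
    using assms(3) by force
  then show j: "j \<in> q - dom f"
    unfolding j_def using assms(1,2) by (intro first_right_in) auto
  show e: "q - dom (f(j \<mapsto> w i)) = q - dom f - {j}"
    by auto
  show "card (q - dom (f(j \<mapsto> w i))) = m"
    unfolding e using j assms(3) by simp
qed

text \<open>Nothing set is overwritten, so the final letter of a site is the one it receives when it
  is taken.\<close>

lemma phase2_extends:
  assumes "q \<subseteq> {1..n}" "set xs \<subseteq> {1..n}" "card (q - dom f) = length xs"
  shows "f \<subseteq>\<^sub>m fold (phase2_step n q w) xs f \<and>
    dom (fold (phase2_step n q w) xs f) = dom f \<union> q"
  using assms
proof (induction xs arbitrary: f)
  case Nil
  then have "q - dom f = {}"
    using finite_subset[of q "{1..n}"] by auto
  then show ?case by auto
next
  case (Cons i xs)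
  then have i: "i \<in> {1..n}" and c: "card (q - dom f) = Suc (length xs)" by auto
  note st = phase2_step_site(1)[OF Cons.prems(1) i c, where w = w] phase2_step_site(2)[OF Cons.prems(1) i c]
    phase2_step_site(3,4)[OF Cons.prems(1) i c, where w = w]
  let ?j = "first_right n (q - dom f) i"
  let ?f = "f(?j \<mapsto> w i)"
  have IH: "?f \<subseteq>\<^sub>m fold (phase2_step n q w) xs ?f \<and>
    dom (fold (phase2_step n q w) xs ?f) = dom ?f \<union> q"
    by (rule Cons.IH[OF Cons.prems(1) _ st(4)]) (use Cons.prems in simp)
  have "f \<subseteq>\<^sub>m ?f" using st(2) by (auto simp: map_le_def)
  then show ?case
    using IH st(2) by (auto simp: st(1) intro: map_le_trans)
qed

text \<open>
  When the letter at \<open>i\<close> is placed, all sites that end up with larger letters are still free.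
\<close>

lemma phase2_matching:
  assumes "q \<subseteq> {1..n}" "set xs \<subseteq> {1..n}" "distinct xs" "sorted (map w xs)"
    and "card (q - dom f) = length xs"
    and "\<And>j. j \<in> q - dom f \<Longrightarrow> fold (phase2_step n q w) xs f j = Some (u j)"
  shows "\<exists>\<sigma>. bij_betw \<sigma> (set xs) (q - dom f) \<and> (\<forall>i\<in>set xs. u (\<sigma> i) = w i \<and>
    (\<exists>F. F \<subseteq> q \<and> {b \<in> q - dom f. w i < u b} \<subseteq> F \<and> \<sigma> i = first_right n F i))"
  using assms
proof (induction xs arbitrary: f)
  case Nil
  then have "q - dom f = {}"
    using finite_subset[of q "{1..n}"] by auto
  then show ?case by (auto simp: bij_betw_def)
next
  case (Cons i xs)
  then have i: "i \<in> {1..n}" and c: "card (q - dom f) = Suc (length xs)" by auto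
  note st = phase2_step_site(1)[OF Cons.prems(1) i c, where w = w] phase2_step_site(2)[OF Cons.prems(1) i c]
    phase2_step_site(3,4)[OF Cons.prems(1) i c, where w = w]
  define j where "j = first_right n (q - dom f) i"
  note st = st[folded j_def]
  let ?f = "f(j \<mapsto> w i)"
  have fin: "fold (phase2_step n q w) xs ?f b = Some (u b)" if "b \<in> q - dom f" for b
    using Cons.prems(6)[OF that] by (simp add: st(1))
  have "?f \<subseteq>\<^sub>m fold (phase2_step n q w) xs ?f"
    using phase2_extends[of q n xs ?f w] Cons.prems st(4) by simp
  then have "Some (u j) = Some (w i)"
    using fin[OF st(2)] by (metis domIff fun_upd_same map_le_def option.distinct(1))
  then have uj: "u j = w i" by simp
  have "\<exists>\<sigma>. bij_betw \<sigma> (set xs) (q - dom ?f) \<and> (\<forall>i\<in>set xs. u (\<sigma> i) = w i \<and>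
    (\<exists>F. F \<subseteq> q \<and> {b \<in> q - dom ?f. w i < u b} \<subseteq> F \<and> \<sigma> i = first_right n F i))"
  proof (rule Cons.IH[OF Cons.prems(1) _ _ _ st(4)])
    fix b assume "b \<in> q - dom ?f"
    then show "fold (phase2_step n q w) xs ?f b = Some (u b)"
      unfolding st(3) by (intro fin) blast
  qed (use Cons.prems in auto)
  then obtain \<sigma> where \<sigma>: "bij_betw \<sigma> (set xs) (q - dom f - {j})"
    and \<sigma>': "\<And>i. i \<in> set xs \<Longrightarrow> u (\<sigma> i) = w i"
    "\<And>i. i \<in> set xs \<Longrightarrow> \<exists>F. F \<subseteq> q \<and> {b \<in> q - dom f - {j}. w i < u b} \<subseteq> F \<and> \<sigma> i = first_right n F i"
    unfolding st(3) by blast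
  have nin: "i \<notin> set xs" using Cons.prems by simp
  let ?\<sigma> = "\<sigma>(i := j)"
  have "bij_betw ?\<sigma> (set xs) (q - dom f - {j})"
    using \<sigma> nin by (subst bij_betw_cong[of _ _ \<sigma>]) auto
  then have "bij_betw ?\<sigma> (set xs \<union> {i}) (q - dom f - {j} \<union> {?\<sigma> i})"
    by (intro notIn_Un_bij_betw) (use nin in auto)
  moreover have "q - dom f - {j} \<union> {?\<sigma> i} = q - dom f"
    using st(2) by auto
  ultimately have "bij_betw ?\<sigma> (set (i # xs)) (q - dom f)" by simp
  moreover have "u (?\<sigma> m) = w m \<and>
    (\<exists>F. F \<subseteq> q \<and> {b \<in> q - dom f. w m < u b} \<subseteq> F \<and> ?\<sigma> m = first_right n F m)"
    if m: "m \<in> set (i # xs)" for m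
  proof (cases "m = i")
    case True
    then show ?thesis using uj by (auto simp: j_def)
  next
    case False
    then have mx: "m \<in> set xs" using m by simp
    then have "w i \<le> w m" using Cons.prems by simp
    \<comment> \<open>The site taken first carries \<open>w i\<close>, which is at most
      \<open>w m\<close>, so it is not among the sites reserved for letters larger than
      \<open>w m\<close>.\<close>
    then have "{b \<in> q - dom f - {j}. w m < u b} = {b \<in> q - dom f. w m < u b}"
      using uj by auto
    then show ?thesis using \<sigma>'[OF mx] False by auto
  qed
  ultimately show ?case by blast
qed

text \<open>
  The last two hypotheses form a Hall condition for letters and free sites; greedy parking
  preserves it whatever the order in which equal letters are processed.
\<close>

lemma phase2_greedy:
  assumes q: "q \<subseteq> {1..n}"
    and u_anti: "\<And>b b'. b \<in> q \<Longrightarrow> b' \<in> q \<Longrightarrow> b < b' \<Longrightarrow> u b' \<le> u b"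
    and u_le: "\<And>b. b \<in> q \<Longrightarrow> u b \<le> L"
    and "set zs \<subseteq> {1..n}" "distinct zs" "sorted (map w zs)"
    and "card (q - dom f) = length zs"
    and "\<And>c. c \<in> set zs \<Longrightarrow> w c \<le> L"
    and "\<And>c b. c \<in> set zs \<Longrightarrow> w c < L \<Longrightarrow> b \<in> q \<Longrightarrow> w c < u b \<Longrightarrow> b < c"
    and "\<And>a t. a < L \<Longrightarrow> card {c \<in> set zs. w c = a \<and> t < c} \<le> card {b \<in> q - dom f. u b = a \<and> t < b}"
    and "\<And>a. a < L \<Longrightarrow> card {c \<in> set zs. w c = a} = card {b \<in> q - dom f. u b = a}"
    and "j \<in> q - dom f"
  shows "fold (phase2_step n q w) zs f j = Some (u j)"
  using assms(4-)
proof (induction zs arbitrary: f)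
  case Nil
  then have "q - dom f = {}"
    using finite_subset[OF q] by auto
  then show ?case using Nil.prems by auto
next
  case (Cons i zs)
  then have i: "i \<in> {1..n}" and c: "card (q - dom f) = Suc (length zs)" by auto
  note st = phase2_step_site(1)[OF q i c, where w = w] phase2_step_site(2)[OF q i c]
    phase2_step_site(3,4)[OF q i c, where w = w]
  define p where "p = first_right n (q - dom f) i"
  note st = st[folded p_def]
  let ?f = "f(p \<mapsto> w i)"
  let ?F = "q - dom f"
  have finF: "finite ?F" using finite_subset[OF q] by simp
  have nin: "i \<notin> set zs" using Cons.prems by simp
  have main: "u p = w i \<and>
      (\<forall>a<L. (\<forall>t. card {c \<in> set zs. w c = a \<and> t < c} \<le> card {b \<in> ?F - {p}. u b = a \<and> t < b}) \<and>
        card {c \<in> set zs. w c = a} = card {b \<in> ?F - {p}. u b = a})"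
  proof (cases "w i < L")
    case False
    \<comment> \<open>By sortedness only letters \<open>L\<close> remain, and by the equality of
      counts only sites destined for \<open>L\<close> are free. Any landing place is then correct,
      even after wrapping.\<close>
    then have wi: "w i = L" using Cons.prems(5)[of i] by simp
    have all: "w m = L" if "m \<in> set zs" for m
      using Cons.prems(3) Cons.prems(5)[of m] wi that by (simp add: antisym)
    have none: "{b \<in> ?F. u b = a} = {}" if "a < L" for a
    proof -
      have "{c \<in> set (i # zs). w c = a} = {}" using all wi that by auto
      then have "card {b \<in> ?F. u b = a} = 0" using Cons.prems(8)[OF that] by (simp only: card.empty)
      moreover have "finite {b \<in> ?F. u b = a}"
        using finF by (rule rev_finite_subset) auto
      ultimately show ?thesis by (simp only: card_0_eq)
    qed
    have "\<not> u p < L" using none[of "u p"] st(2) by blast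
    then have "u p = w i" using u_le[of p] st(2) wi by simp
    moreover have "card {c \<in> set zs. w c = a \<and> t < c} \<le> m"
      "card {c \<in> set zs. w c = a} = card {b \<in> ?F - {p}. u b = a}" if "a < L" for a t m
    proof -
      have e: "{c \<in> set zs. w c = a \<and> t < c} = {}" "{c \<in> set zs. w c = a} = {}"
        "{b \<in> ?F - {p}. u b = a} = {}"
        using all none[OF that] that by auto
      show "card {c \<in> set zs. w c = a \<and> t < c} \<le> m"
        "card {c \<in> set zs. w c = a} = card {b \<in> ?F - {p}. u b = a}"
        by (simp_all only: e card.empty le0)
    qed
    ultimately show ?thesis by blast
  next
    case True
    \<comment> \<open>With threshold \<open>i - 1\<close> the letter at \<open>i\<close> itself is
      counted, so the Hall condition yields a free site \<open>b \<ge> i\<close> destined for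
      \<open>w i\<close>. The nearest free site \<open>p\<close> is at most \<open>b\<close>, whence
      \<open>u p \<ge> w i\<close>; equality holds because sites for larger letters lie before
      \<open>i\<close>.\<close>
    have "i \<in> {c \<in> set (i # zs). w c = w i \<and> i - 1 < c}" using i by auto
    then have "0 < card {c \<in> set (i # zs). w c = w i \<and> i - 1 < c}"
      by (subst card_gt_0_iff) auto
    then have "0 < card {b \<in> ?F. u b = w i \<and> i - 1 < b}"
      using Cons.prems(7)[OF True, of "i - 1"] by linarith
    then have "{b \<in> ?F. u b = w i \<and> i - 1 < b} \<noteq> {}"
      unfolding card_gt_0_iff by (rule conjunct1)
    then obtain b where b: "b \<in> ?F" "u b = w i" "i - 1 < b"
      by blast
    then have ib: "i \<le> b" by simp
    have p: "p = Min {m \<in> ?F. i \<le> m}"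
      unfolding p_def by (rule first_right_ahead) (use i q b ib in auto)
    have finI: "finite {m \<in> ?F. i \<le> m}" by (rule finite_subset[OF _ finF]) auto
    have pmin: "p \<le> m" if "m \<in> ?F" "i \<le> m" for m
      unfolding p by (rule Min_le[OF finI]) (use that in blast)
    have "p \<in> {m \<in> ?F. i \<le> m}"
      unfolding p by (rule Min_in[OF finI]) (use b ib in blast)
    then have ip: "i \<le> p" "p \<in> ?F" by auto
    have "u b \<le> u p"
      using u_anti[of p b] pmin[OF b(1) ib] ip b by (cases "p = b") auto
    moreover have "\<not> w i < u p"
      using Cons.prems(6)[of i p] True ip by fastforce
    ultimately have up: "u p = w i" using b by simp
    have cars: "card {c \<in> set (i # zs). P c} = (if P i then 1 else 0) + card {c \<in> set zs. P c}" for P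
    proof -
      have "{c \<in> set (i # zs). P c} = (if P i then insert i {c \<in> set zs. P c} else {c \<in> set zs. P c})"
        by auto
      then show ?thesis using nin by simp
    qed
    have sites: "card {b \<in> ?F. P b} = (if P p then 1 else 0) + card {b \<in> ?F - {p}. P b}" for P
    proof -
      have "{b \<in> ?F. P b} = (if P p then insert p {b \<in> ?F - {p}. P b} else {b \<in> ?F - {p}. P b})"
        using ip by auto
      moreover have "card (insert p {b \<in> ?F - {p}. P b}) = 1 + card {b \<in> ?F - {p}. P b}"
        by (subst card_insert_disjoint) (use finite_subset[OF _ finF, of "{b \<in> ?F - {p}. P b}"] in auto)
      ultimately show ?thesis by presburger
    qed
    have hall: "card {c \<in> set zs. w c = a \<and> t < c} \<le> card {b \<in> ?F - {p}. u b = a \<and> t < b}"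
      if a: "a < L" for a t
    proof (cases "a = w i \<and> i \<le> t \<and> t < p")
      case False
      then have e: "(w i = a \<and> t < i) = (u p = a \<and> t < p)"
        using ip up by auto
      show ?thesis
        using Cons.prems(7)[OF a, of t] unfolding cars sites e by linarith
    next
      case t: True
      \<comment> \<open>This is the only range of thresholds where a site is lost but no letter. No
        free site lies between \<open>i\<close> and \<open>p\<close>, so the condition at
        \<open>i - 1\<close> applies, and there the letter at \<open>i\<close> provides the missing
        unit.\<close>
      have "{b \<in> ?F. u b = a \<and> i - 1 < b} = {b \<in> ?F. u b = a \<and> t < b}"
        using t pmin i by fastforce
      then have "card {c \<in> set (i # zs). w c = a \<and> i - 1 < c} \<le> card {b \<in> ?F. u b = a \<and> t < b}"
        using Cons.prems(7)[OF a, of "i - 1"] by (simp only:)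
      moreover have "card {c \<in> set zs. w c = a \<and> t < c} \<le> card {c \<in> set zs. w c = a \<and> i - 1 < c}"
        using t by (intro card_mono) auto
      moreover have "w i = a \<and> i - 1 < i" "u p = a \<and> t < p" using i t up by auto
      ultimately show ?thesis
        unfolding cars[of "\<lambda>c. w c = a \<and> i - 1 < c"] sites[of "\<lambda>b. u b = a \<and> t < b"] by simp
    qed
    have "card {c \<in> set zs. w c = a} = card {b \<in> ?F - {p}. u b = a}" if a: "a < L" for a
      using Cons.prems(8)[OF a] unfolding cars sites up by linarith
    with hall up show ?thesis by blast
  qed
  show ?case
  proof (cases "j = p")
    case True
    have "?f \<subseteq>\<^sub>m fold (phase2_step n q w) zs ?f"
      using phase2_extends[of q n zs ?f w] Cons.prems q st(4) by simp
    then have "fold (phase2_step n q w) zs ?f p = Some (w i)"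
      by (metis domI fun_upd_same map_le_def)
    then show ?thesis using True main by (simp add: st(1))
  next
    case False
    have "fold (phase2_step n q w) zs ?f j = Some (u j)"
    proof (rule Cons.IH[OF _ _ _ st(4)])
      show "set zs \<subseteq> {1..n}" "distinct zs" "sorted (map w zs)" "j \<in> q - dom ?f"
        using Cons.prems False by auto
    next
      fix c assume "c \<in> set zs"
      then show "w c \<le> L" using Cons.prems(5) by simp
    next
      fix c b assume "c \<in> set zs" "w c < L" "b \<in> q" "w c < u b"
      then show "b < c" using Cons.prems(6) by simp
    next
      fix a assume "a < L"
      then show "card {c \<in> set zs. w c = a \<and> t < c} \<le> card {b \<in> q - dom ?f. u b = a \<and> t < b}"
        "card {c \<in> set zs. w c = a} = card {b \<in> q - dom ?f. u b = a}" for t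
        using main unfolding st(3) by blast+
    qed
    then show ?thesis by (simp add: st(1))
  qed
qed

section \<open>Queues producing a decreasing word\<close>

definition list_word :: "nat \<Rightarrow> nat list \<Rightarrow> nat list \<Rightarrow> nat \<Rightarrow> nat" where
  "list_word l bs vs i = (case map_of (zip bs vs) i of Some a \<Rightarrow> a | None \<Rightarrow> l)"

lemma list_word_nth:
  "distinct bs \<Longrightarrow> length vs = length bs \<Longrightarrow> j < length bs \<Longrightarrow> list_word l bs vs (bs ! j) = vs ! j"
  by (simp add: list_word_def map_of_zip_nth)

lemma list_word_notin: "length vs = length bs \<Longrightarrow> i \<notin> set bs \<Longrightarrow> list_word l bs vs i = l"
  by (simp add: list_word_def map_of_zip_is_None[THEN iffD2])

lemma sorting_order_length: "sorting_order n w ord \<Longrightarrow> length ord = n"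
  using distinct_card[of ord] by (simp add: sorting_order_def)

lemma sorting_order_ex: "\<exists>ord. sorting_order n w ord"
proof
  show "sorting_order n w (sort_key w [1..<Suc n])"
    by (auto simp: sorting_order_def)
qed

lemma queue_fill_phase1:
  assumes q: "q \<subseteq> {1..n}" and ord: "sorting_order n w ord"
  defines "f \<equiv> fold (phase1_step n q w) (rev (drop (card q) ord)) Map.empty"
  shows "queue_fill n q w ord = fold (phase2_step n q w) (take (card q) ord) f"
    and "dom f = {1..n} - q" and "ran f = (\<lambda>i. w i + 1) ` set (drop (card q) ord)"
    and "length (take (card q) ord) = card q"
    and "f \<subseteq>\<^sub>m queue_fill n q w ord" and "dom (queue_fill n q w ord) = {1..n}"
proof -
  have fin: "finite q" using finite_subset[OF q] by simp
  have cq: "card q \<le> n" using card_mono[OF _ q] by simp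
  have set_ord: "set ord = {1..n}" using ord by (simp add: sorting_order_def)
  show qf: "queue_fill n q w ord = fold (phase2_step n q w) (take (card q) ord) f"
    by (simp add: queue_fill_def f_def)
  have "set (rev (drop (card q) ord)) \<subseteq> {1..n}"
    using set_ord set_drop_subset[of "card q" ord] by auto
  moreover have "card ({1..n} - q) = length (rev (drop (card q) ord))"
    using sorting_order_length[OF ord] fin q by (simp add: card_Diff_subset)
  ultimately have "dom f = {1..n} - q \<and> ran f = (\<lambda>i. w i + 1) ` set (drop (card q) ord)"
    unfolding f_def using phase1_fill[OF q, of Map.empty "rev (drop (card q) ord)" w] by simp
  then show f: "dom f = {1..n} - q" "ran f = (\<lambda>i. w i + 1) ` set (drop (card q) ord)"
    by auto
  show len: "length (take (card q) ord) = card q"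
    using sorting_order_length[OF ord] cq by simp
  have "q - dom f = q" using f by auto
  then have "f \<subseteq>\<^sub>m fold (phase2_step n q w) (take (card q) ord) f \<and>
      dom (fold (phase2_step n q w) (take (card q) ord) f) = dom f \<union> q"
    using set_ord set_take_subset[of "card q" ord] len by (intro phase2_extends[OF q]) auto
  then show "f \<subseteq>\<^sub>m queue_fill n q w ord" "dom (queue_fill n q w ord) = {1..n}"
    using f q by (auto simp: qf)
qed

lemma sorting_order_split:
  assumes "sorting_order n w ord"
  shows "set (take r ord) \<union> set (drop r ord) = {1..n}" "distinct (take r ord)" "sorted (map w (take r ord))"
    and "set (take r ord) \<inter> set (drop r ord) = {}"
    and "i \<in> set (take r ord) \<Longrightarrow> i' \<in> set (drop r ord) \<Longrightarrow> w i \<le> w i'"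
proof -
  have e: "ord = take r ord @ drop r ord" by simp
  show "set (take r ord) \<union> set (drop r ord) = {1..n}"
    using assms unfolding sorting_order_def by (metis e set_append)
  show "distinct (take r ord)" "set (take r ord) \<inter> set (drop r ord) = {}"
    using assms unfolding sorting_order_def by (metis e distinct_append)+
  have "sorted (map w (take r ord) @ map w (drop r ord))"
    using assms unfolding sorting_order_def by (metis e map_append)
  then have "sorted (map w (take r ord))"
    and *: "\<forall>a\<in>w ` set (take r ord). \<forall>b\<in>w ` set (drop r ord). a \<le> b"
    unfolding sorted_append by simp_all
  then show "sorted (map w (take r ord))" by simp
  show "w i \<le> w i'" if "i \<in> set (take r ord)" "i' \<in> set (drop r ord)"
    using * that by blast
qed

context decreasing_word
begin

abbreviation u :: "nat \<Rightarrow> nat" where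
  "u \<equiv> list_word l bs vs"

text \<open>Sites off the chain hold \<open>l - 1\<close>. Exactly \<open>k\<close> of these letters
  take part in Phase II and end on the first \<open>k\<close> sites of \<open>bs\<close>; the others
  become \<open>l\<close> in Phase I.\<close>

abbreviation chain_word :: "nat list \<Rightarrow> nat \<Rightarrow> nat" where
  "chain_word cs \<equiv> list_word (l - 1) cs (drop k vs)"

lemma distinct_bs: "distinct bs"
  using sorted_bs by (simp add: strict_sorted_iff)

lemma u_bs: "j < length bs \<Longrightarrow> u (bs ! j) = vs ! j"
  using distinct_bs length_vs by (simp add: list_word_nth)

lemma u_off: "i \<notin> set bs \<Longrightarrow> u i = l"
  using length_vs by (simp add: list_word_notin)

lemma u_le: "b \<in> set bs \<Longrightarrow> u b \<le> l - 1"
  using u_bs vs_bounds(2) by (auto simp: in_set_conv_nth)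

lemma u_anti: "b \<in> set bs \<Longrightarrow> b' \<in> set bs \<Longrightarrow> b \<le> b' \<Longrightarrow> u b' \<le> u b"
proof -
  assume "b \<in> set bs" "b' \<in> set bs" "b \<le> b'"
  then obtain i j where ij: "i < length bs" "j < length bs" "b = bs ! i" "b' = bs ! j"
    by (metis in_set_conv_nth)
  then have "i \<le> j" using bs_mono[of j i] \<open>b \<le> b'\<close> by (cases "j < i") auto
  then show ?thesis using ij u_bs vs_anti by simp
qed

lemma u_low: "{b \<in> set bs. u b < l - 1} = set (drop k bs)"
proof (intro equalityI subsetI)
  fix b assume "b \<in> {b \<in> set bs. u b < l - 1}"
  then obtain j where j: "j < length bs" "b = bs ! j" "vs ! j < l - 1"
    using u_bs by (auto simp: in_set_conv_nth)
  then have "k \<le> j" using vs_top[of j] by (cases "j < k") auto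
  then show "b \<in> set (drop k bs)"
    using j by (auto simp: in_set_conv_nth intro!: exI[of _ "j - k"])
next
  fix b assume "b \<in> set (drop k bs)"
  then obtain j where "j < length bs - k" "b = bs ! (k + j)"
    using k_le by (auto simp: in_set_conv_nth)
  then have j: "k + j < length bs" "b = bs ! (k + j)" by auto
  then show "b \<in> {b \<in> set bs. u b < l - 1}"
    using u_bs vs_low[of "k + j"] by simp
qed

lemma map_u_drop: "map u (drop k bs) = drop k vs"
  by (rule nth_equalityI) (use length_vs u_bs k_le in auto)

text \<open>The site \<open>bs ! 0\<close> is destined for \<open>l - 1\<close> and hence lies in
  \<open>F\<close>. A wrapping letter would land on the minimum of \<open>F\<close>, at or before
  \<open>bs ! 0\<close>, where \<open>u\<close> is too large. Likewise, if a site
  \<open>b \<ge> i\<close> were destined for a larger letter, then \<open>s \<le> b\<close>, and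
  monotonicity would give \<open>u b \<le> u s = w i\<close>.\<close>

lemma matching_ahead:
  assumes i: "i \<in> {1..n}" "w i < l - 1" "u s = w i"
    and F: "F \<subseteq> set bs" "{b \<in> set bs. w i < u b} \<subseteq> F" "s = first_right n F i"
  shows "i \<le> s" and "\<And>b. b \<in> set bs \<Longrightarrow> w i < u b \<Longrightarrow> b < i"
proof -
  have len: "0 < length bs" using k_pos k_le by linarith
  have b0: "bs ! 0 \<in> set bs" "u (bs ! 0) = l - 1"
    using len u_bs vs_top k_pos by auto
  then have b0F: "bs ! 0 \<in> F" using F i by auto
  have Fn: "F \<subseteq> {1..n}" using F bs_sites by blast
  then have fin: "finite F" by (rule finite_subset) simp
  have ex: "\<exists>f\<in>F. i \<le> f"
  proof (rule ccontr)
    assume "\<not> ?thesis"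
    then have "s = Min F"
      unfolding F(3) using b0F Fn i by (intro first_right_wrap) auto
    moreover have "Min F \<in> F" "Min F \<le> bs ! 0"
      using fin b0F by (auto intro!: Min_in)
    ultimately have "s \<in> F" "s \<le> bs ! 0" by simp_all
    then have "u (bs ! 0) \<le> u s" using u_anti b0(1) F(1) by blast
    then show False using b0 i by simp
  qed
  have s: "s = Min {f \<in> F. i \<le> f}"
    unfolding F(3) by (rule first_right_ahead[OF i(1) Fn ex])
  have finI: "finite {f \<in> F. i \<le> f}" using fin by simp
  then have "s \<in> {f \<in> F. i \<le> f}"
    unfolding s using ex by (intro Min_in) auto
  then show "i \<le> s" by simp
  fix b assume b: "b \<in> set bs" "w i < u b"
  show "b < i"
  proof (rule ccontr)
    assume "\<not> b < i"
    then have "s \<le> b"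
      unfolding s using finI b F by (intro Min_le) auto
    then have "u b \<le> u s"
      using u_anti b(1) F(1) \<open>s \<in> {f \<in> F. i \<le> f}\<close> by blast
    then show False using b i by simp
  qed
qed

lemma chain_of_matching:
  assumes C: "C \<subseteq> {1..n}" and \<sigma>: "bij_betw \<sigma> C (set (drop k bs))"
    and u\<sigma>: "\<And>c. c \<in> C \<Longrightarrow> u (\<sigma> c) = w c" and ahead: "\<And>c. c \<in> C \<Longrightarrow> c \<le> \<sigma> c"
    and sep: "\<And>c b. c \<in> C \<Longrightarrow> b \<in> set bs \<Longrightarrow> w c < u b \<Longrightarrow> b < c"
  defines "cs \<equiv> sorted_list_of_set C"
  shows "cs \<in> chains (length bs - k)" and "map w cs = drop k vs"
proof -
  have finC: "finite C" using finite_subset[OF C] by simp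
  have inj: "inj_on \<sigma> C" and img: "\<sigma> ` C = set (drop k bs)"
    using \<sigma> by (auto simp: bij_betw_def)
  have cs: "set cs = C" "distinct cs" "sorted_wrt (<) cs"
    using finC by (simp_all add: cs_def)
  have ddrop: "distinct (drop k bs)" using distinct_bs by simp
  have "card C = length bs - k"
    using bij_betw_same_card[OF \<sigma>] distinct_card[OF ddrop] by simp
  then have len: "length cs = length bs - k"
    using cs distinct_card by metis
  have cs_less: "cs ! i < cs ! j" if "i < j" "j < length cs" for i j
    using cs(3) that by (simp add: sorted_wrt_iff_nth_less)
  have in_bs: "\<sigma> c \<in> set bs" if "c \<in> C" for c
    using img that by (metis image_eqI in_set_dropD)
  \<comment> \<open>If a larger letter stood at \<open>c'\<close> to the right of \<open>c\<close>,
    its target would lie before \<open>c\<close> by \<open>sep\<close>, although it is at or after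
    \<open>c'\<close>.\<close>
  have anti: "w c' \<le> w c" if "c \<in> C" "c' \<in> C" "c < c'" for c c'
  proof (rule ccontr)
    assume "\<not> w c' \<le> w c"
    then have "\<sigma> c' < c" using sep[of c "\<sigma> c'"] u\<sigma> in_bs that by simp
    then show False using ahead[of c'] that by simp
  qed
  have "mset (map w cs) = image_mset w (mset_set C)"
    using cs by (metis mset_map mset_set_set)
  also have "\<dots> = image_mset (u \<circ> \<sigma>) (mset_set C)"
    using finC u\<sigma> by (intro image_mset_cong) simp
  also have "\<dots> = image_mset u (mset_set (set (drop k bs)))"
    using image_mset_mset_set[OF inj] img by (metis multiset.map_comp)
  also have "\<dots> = mset (drop k vs)"
    using ddrop by (metis map_u_drop mset_map mset_set_set)
  finally have "mset (rev (map w cs)) = mset (rev (drop k vs))" by simp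
  moreover have "sorted_wrt (\<ge>) (map w cs)"
    using anti cs cs_less by (auto simp: sorted_wrt_iff_nth_less)
  then have "sorted (rev (map w cs))"
    by (simp only: sorted_wrt_rev)
  moreover have "sorted (rev (drop k vs))"
    using sorted_wrt_drop[OF vs_decreasing, of k] by (simp add: sorted_wrt_rev)
  ultimately have "rev (map w cs) = rev (drop k vs)"
    by (metis properties_for_sort sorted_sort_id)
  then show eq: "map w cs = drop k vs" by simp
  have wcs: "w (cs ! j) = vs ! (k + j)" if "j < length cs" for j
    using arg_cong[OF eq, of "\<lambda>xs. xs ! j"] that len length_vs k_le by simp
  \<comment> \<open>Pigeonhole: otherwise the letters at \<open>cs ! j\<close> and all later chain
    sites would move injectively to sites beyond \<open>bs ! (k + j)\<close>, and there is one too
    few of these.\<close>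
  have upper: "cs ! j \<le> bs ! (k + j)" if j: "j < length cs" for j
  proof (rule ccontr)
    assume *: "\<not> ?thesis"
    let ?I = "{j..<length cs}"
    have "(\<lambda>i. \<sigma> (cs ! i)) ` ?I \<subseteq> (\<lambda>i. bs ! i) ` {k + j<..<length bs}"
    proof
      fix b assume "b \<in> (\<lambda>i. \<sigma> (cs ! i)) ` ?I"
      then obtain i where i: "j \<le> i" "i < length cs" "b = \<sigma> (cs ! i)" by auto
      then have iC: "cs ! i \<in> C" using cs by auto
      have "cs ! j \<le> cs ! i" using cs_less[of j i] i by (cases "i = j") auto
      then have "bs ! (k + j) < b" using * ahead[OF iC] i by simp
      moreover obtain m where m: "m < length bs" "b = bs ! m"
        using in_bs[OF iC] i by (metis in_set_conv_nth)
      moreover have "k + j < length bs" using j len by simp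
      ultimately have "k + j < m"
        using bs_mono_le[of m "k + j"] by (cases "m \<le> k + j") auto
      then show "b \<in> (\<lambda>i. bs ! i) ` {k + j<..<length bs}" using m by auto
    qed
    then have "card ((\<lambda>i. \<sigma> (cs ! i)) ` ?I) \<le> card ((\<lambda>i. bs ! i) ` {k + j<..<length bs})"
      by (intro card_mono) auto
    also have "\<dots> \<le> length bs - (k + j) - 1"
      using card_image_le[of "{k + j<..<length bs}" "\<lambda>i. bs ! i"] by simp
    finally have "card ((\<lambda>i. \<sigma> (cs ! i)) ` ?I) \<le> length bs - (k + j) - 1" .
    moreover have "inj_on (\<lambda>i. \<sigma> (cs ! i)) ?I"
    proof (rule inj_onI)
      fix a b assume ab: "a \<in> ?I" "b \<in> ?I" "\<sigma> (cs ! a) = \<sigma> (cs ! b)"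
      then have "cs ! a = cs ! b"
        using inj cs by (auto dest: inj_onD)
      then show "a = b" using ab cs(2) by (simp add: nth_eq_iff_index_eq)
    qed
    then have "card ((\<lambda>i. \<sigma> (cs ! i)) ` ?I) = length cs - j"
      by (simp add: card_image)
    ultimately show False using len j by simp
  qed
  show "cs \<in> chains (length bs - k)"
    unfolding chains_def
  proof (intro CollectI conjI allI impI len)
    fix j assume "j < length bs - k"
    then have j: "j < length cs" "k + j < length bs" using len by auto
    then show "cs ! j \<le> bs ! (k + j)" by (intro upper)
    show "lower cs j < cs ! j"
    proof (cases "vs ! (k + j) = vs ! (k + j - 1)")
      case True
      then have "j \<noteq> 0" using vs_k j by (cases "j = 0") auto
      then show ?thesis using True cs_less[of "j - 1" j] j by (simp add: lower_def)
    next
      case False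
      have j': "0 < k + j" "k + j - 1 < length bs" using k_pos j by auto
      have ww: "w (cs ! j) < u (bs ! (k + j - 1))"
        using vs_start[OF j'(1) j(2) False] wcs[OF j(1)] u_bs[OF j'(2)] by simp
      have "cs ! j \<in> C" using cs(1) nth_mem[OF j(1)] by simp
      from sep[OF this nth_mem[OF j'(2)] ww] have "bs ! (k + j - 1) < cs ! j" .
      then show ?thesis using False by (simp add: lower_def)
    qed
  qed
qed

lemma queue_fill_imp_chain:
  assumes q: "q \<subseteq> {1..n}" "card q = length bs" and ord: "sorting_order n w ord"
    and fill: "\<And>i. i \<in> {1..n} \<Longrightarrow> queue_fill n q w ord i = Some (u i)"
  shows "q = set bs" and "\<exists>cs\<in>chains (length bs - k). \<forall>i\<in>{1..n}. w i = chain_word cs i"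
proof -
  define r where "r = card q"
  define f where "f = fold (phase1_step n q w) (rev (drop r ord)) Map.empty"
  note ph = queue_fill_phase1[OF q(1) ord, folded r_def, folded f_def]
  note sp = sorting_order_split[OF ord, where r = r]
  have qd: "q - dom f = q" using ph(2) by auto
  have tk: "set (take r ord) \<subseteq> {1..n}" using sp(1) by auto
  have "\<exists>\<sigma>. bij_betw \<sigma> (set (take r ord)) (q - dom f) \<and> (\<forall>i\<in>set (take r ord). u (\<sigma> i) = w i \<and>
    (\<exists>F. F \<subseteq> q \<and> {b \<in> q - dom f. w i < u b} \<subseteq> F \<and> \<sigma> i = first_right n F i))"
  proof (rule phase2_matching[OF q(1) tk sp(2,3)])
    show "card (q - dom f) = length (take r ord)" using ph(4) qd r_def by simp
    show "fold (phase2_step n q w) (take r ord) f j = Some (u j)" if "j \<in> q - dom f" for j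
      using fill[of j] that q ph(1) by auto
  qed
  then obtain \<sigma> where \<sigma>: "bij_betw \<sigma> (set (take r ord)) q"
    and u\<sigma>: "\<And>i. i \<in> set (take r ord) \<Longrightarrow> u (\<sigma> i) = w i"
    and F\<sigma>: "\<And>i. i \<in> set (take r ord) \<Longrightarrow>
      \<exists>F. F \<subseteq> q \<and> {b \<in> q. w i < u b} \<subseteq> F \<and> \<sigma> i = first_right n F i"
    unfolding qd by blast
  have offq: "f j = Some (u j)" if "j \<in> {1..n}" "j \<notin> q" for j
  proof -
    have "j \<in> dom f" using ph(2) that by simp
    then show ?thesis using ph(5) fill[OF that(1)] by (auto simp: map_le_def)
  qed
  have lpos: "l - 1 < l" using l_ge_2 by simp
  show qbs: "q = set bs"
  proof (rule ccontr)
    assume ne: "q \<noteq> set bs"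
    \<comment> \<open>Equal sizes give a site \<open>a\<close> of \<open>q\<close> outside
      \<open>bs\<close> and a site \<open>b\<close> of \<open>bs\<close> outside \<open>q\<close>.
      Then \<open>a\<close> receives \<open>l\<close> in Phase II, so every Phase I letter is at
      least \<open>l\<close> and increases by one, whereas \<open>b\<close> must receive at most
      \<open>l - 1\<close>.\<close>
    have cards: "card q = card (set bs)" using q distinct_bs by (simp add: distinct_card)
    have "\<not> q \<subseteq> set bs" using ne cards card_subset_eq[of "set bs" q] by auto
    then obtain a where a: "a \<in> q" "a \<notin> set bs" by blast
    have "finite q" using finite_subset[OF q(1)] by simp
    then have "\<not> set bs \<subseteq> q" using ne cards card_subset_eq[of q "set bs"] by auto
    then obtain b where b: "b \<in> set bs" "b \<notin> q" by blast
    obtain i where i: "i \<in> set (take r ord)" "a = \<sigma> i"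
      using \<sigma> a by (auto simp: bij_betw_def)
    have "f b = Some (u b)" using b bs_sites by (intro offq) auto
    then have "u b \<in> ran f" by (auto simp: ran_def)
    then obtain i' where i': "i' \<in> set (drop r ord)" "u b = w i' + 1"
      using ph(3) by auto
    have "l \<le> w i'" using u\<sigma>[OF i(1)] i a u_off sp(5)[OF i(1) i'(1)] by simp
    then show False using i' u_le[OF b(1)] lpos by simp
  qed
  have w_drop: "w i = l - 1" if "i \<in> set (drop r ord)" for i
  proof -
    have "w i + 1 \<in> ran f" using ph(3) that by auto
    then obtain j where j: "f j = Some (w i + 1)" by (auto simp: ran_def)
    then have "j \<in> {1..n}" "j \<notin> q" using ph(2) by blast+
    then have "u j = w i + 1" "u j = l" using offq j u_off qbs by auto
    then show ?thesis by simp
  qed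
  have w_take: "w i \<le> l - 1" if "i \<in> set (take r ord)" for i
    using u\<sigma>[OF that] u_le[of "\<sigma> i"] \<sigma> that qbs by (auto simp: bij_betw_def)
  \<comment> \<open>The matching is restricted to letters below \<open>l - 1\<close>; the letters
    \<open>l - 1\<close> may wrap and satisfy no useful bound.\<close>
  define C where "C = {i \<in> {1..n}. w i < l - 1}"
  have C_take: "C = {i \<in> set (take r ord). w i < l - 1}"
    using sp(1) w_drop unfolding C_def by force
  have "bij_betw \<sigma> C (\<sigma> ` C)"
    using \<sigma> C_take by (auto simp: bij_betw_def intro: inj_on_subset)
  moreover have "\<sigma> ` C = {b \<in> q. u b < l - 1}"
    using \<sigma> u\<sigma> unfolding C_take bij_betw_def by force
  ultimately have \<sigma>C: "bij_betw \<sigma> C (set (drop k bs))"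
    using u_low qbs by simp
  have ahead: "c \<le> \<sigma> c" "\<And>b. b \<in> set bs \<Longrightarrow> w c < u b \<Longrightarrow> b < c" if c: "c \<in> C" for c
  proof -
    have ct: "c \<in> set (take r ord)" "c \<in> {1..n}" "w c < l - 1"
      using c C_take C_def by auto
    obtain F where F: "F \<subseteq> set bs" "{b \<in> set bs. w c < u b} \<subseteq> F" "\<sigma> c = first_right n F c"
      using F\<sigma>[OF ct(1)] qbs by blast
    show "c \<le> \<sigma> c" "\<And>b. b \<in> set bs \<Longrightarrow> w c < u b \<Longrightarrow> b < c"
      using matching_ahead[where w = w and s = "\<sigma> c", OF ct(2,3) u\<sigma>[OF ct(1)] F] by auto
  qed
  define cs where "cs = sorted_list_of_set C"
  have Cn: "C \<subseteq> {1..n}" by (auto simp: C_def)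
  have u\<sigma>C: "u (\<sigma> c) = w c" if "c \<in> C" for c
    using u\<sigma> that C_take by auto
  note ch = chain_of_matching[OF Cn \<sigma>C u\<sigma>C ahead(1) ahead(2), folded cs_def]
  have csC: "set cs = C" "distinct cs"
    using finite_subset[OF Cn] by (simp_all add: cs_def)
  have len: "length (drop k vs) = length cs"
    using arg_cong[OF ch(2), of length] by simp
  have "w i = chain_word cs i" if i: "i \<in> {1..n}" for i
  proof (cases "i \<in> C")
    case True
    then obtain j where j: "j < length cs" "i = cs ! j"
      using csC by (metis in_set_conv_nth)
    then have "w i = drop k vs ! j" using ch(2) by (metis nth_map)
    then show ?thesis using list_word_nth[OF csC(2) len j(1)] j by simp
  next
    case False
    then have "chain_word cs i = l - 1"
      using list_word_notin[OF len] csC by simp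
    moreover have "w i \<le> l - 1" using w_drop w_take sp(1) i by fastforce
    ultimately show ?thesis using False i by (simp add: C_def)
  qed
  then show "\<exists>cs\<in>chains (length bs - k). \<forall>i\<in>{1..n}. w i = chain_word cs i"
    using ch(1) by blast
qed

section \<open>From a chain to the word produced by the last queue\<close>

context
  fixes cs assumes cs: "cs \<in> chains (length bs - k)"
begin

lemma length_chain: "length cs = length bs - k"
  using cs by (simp add: chains_def)

lemma chain_upper: "j < length bs - k \<Longrightarrow> cs ! j \<le> bs ! (k + j)"
  using cs by (simp add: chains_def)

lemma chain_lower: "j < length bs - k \<Longrightarrow> lower cs j < cs ! j"
  using cs by (simp add: chains_def)

lemma chain_sorted: "sorted_wrt (<) cs"
proof -
  have "cs ! j < cs ! Suc j" if j: "Suc j < length cs" for j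
    using chain_lower[of "Suc j"] chain_upper[of j] j length_chain
    by (auto simp: lower_def split: if_splits)
  then show ?thesis
    by (subst sorted_wrt_iff_nth_Suc_transp) auto
qed

lemma chain_distinct: "distinct cs"
  using chain_sorted by (simp add: strict_sorted_iff)

lemma chain_sites: "set cs \<subseteq> {1..n}"
proof
  fix c assume "c \<in> set cs"
  then obtain j where j: "j < length bs - k" "c = cs ! j"
    using length_chain by (metis in_set_conv_nth)
  then have "bs ! (k + j) \<in> set bs" by simp
  then have "bs ! (k + j) \<le> n" using bs_sites by auto
  then show "c \<in> {1..n}" using chain_upper[OF j(1)] chain_lower[OF j(1)] j by auto
qed

text \<open>\<open>lower\<close> imposes the bound only where a block of equal letters starts;
  within the block the chain increases, which carries the bound along.\<close>

lemma chain_sep: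
  assumes "j < length bs - k" "i < length bs" "vs ! (k + j) < vs ! i"
  shows "bs ! i < cs ! j"
  using assms
proof (induction j)
  case 0
  then have "i < k" using vs_anti[of k i] by (cases "i < k") auto
  then have "bs ! i \<le> bs ! (k - 1)" using 0 by (intro bs_mono_le) auto
  then show ?case using chain_lower[OF 0(1)] vs_k 0 by (simp add: lower_def)
next
  case (Suc j)
  have i: "i \<le> k + j" using vs_anti[of "k + Suc j" i] Suc.prems by (cases "i \<le> k + j") auto
  show ?case
  proof (cases "vs ! (k + Suc j) = vs ! (k + Suc j - 1)")
    case True
    then have "bs ! i < cs ! j" using Suc by auto
    also have "\<dots> < cs ! Suc j" using chain_lower[OF Suc.prems(1)] True by (simp add: lower_def)
    finally show ?thesis .
  next
    case False
    have "bs ! i \<le> bs ! (k + j)" using i Suc.prems by (intro bs_mono_le) auto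
    then show ?thesis
      using chain_lower[OF Suc.prems(1)] False by (simp add: lower_def)
  qed
qed

lemma length_drop_chain: "length (drop k vs) = length cs"
  using length_chain length_vs by simp

lemma chain_word_nth: "j < length bs - k \<Longrightarrow> chain_word cs (cs ! j) = vs ! (k + j)"
  using list_word_nth[OF chain_distinct length_drop_chain, of j] length_chain length_vs k_le by simp

lemma chain_word_off: "i \<notin> set cs \<Longrightarrow> chain_word cs i = l - 1"
  using list_word_notin[OF length_drop_chain] .

lemma chain_word_low: "{i \<in> {1..n}. chain_word cs i < l - 1} = set cs"
proof (intro equalityI subsetI)
  fix i assume "i \<in> {i \<in> {1..n}. chain_word cs i < l - 1}"
  then show "i \<in> set cs" using chain_word_off[of i] by (cases "i \<in> set cs") auto
next
  fix i assume i: "i \<in> set cs"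
  then obtain j where "j < length bs - k" "i = cs ! j"
    using length_chain by (metis in_set_conv_nth)
  then show "i \<in> {i \<in> {1..n}. chain_word cs i < l - 1}"
    using chain_word_nth vs_low[of "k + j"] chain_sites i by auto
qed

lemma chain_word_le: "i \<in> {1..n} \<Longrightarrow> chain_word cs i \<le> l - 1"
proof (cases "i \<in> set cs")
  case True
  then have "chain_word cs i < l - 1" using chain_word_low by blast
  then show ?thesis by simp
qed (use chain_word_off[of i] in simp)

text \<open>Pairing \<open>cs ! j\<close> with \<open>bs ! (k + j)\<close> preserves letters and
  never moves to the left. The actual parking may pair them differently, but the counts only need
  some such pairing.\<close>

lemma chain_hall:
  assumes "a < l - 1"
  shows "card {c \<in> set cs. chain_word cs c = a \<and> t < c} \<le> card {b \<in> set bs. u b = a \<and> t < b}"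
    and "card {c \<in> set cs. chain_word cs c = a} = card {b \<in> set bs. u b = a}"
proof -
  let ?s = "length bs - k"
  have c: "{c \<in> set cs. chain_word cs c = a \<and> P c} = (\<lambda>j. cs ! j) ` {j. j < ?s \<and> vs ! (k + j) = a \<and> P (cs ! j)}" for P
    using chain_word_nth length_chain by (auto simp: in_set_conv_nth image_iff)
  have b: "{b \<in> set bs. u b = a \<and> P b} = (\<lambda>j. bs ! (k + j)) ` {j. j < ?s \<and> vs ! (k + j) = a \<and> P (bs ! (k + j))}" for P
  proof (intro equalityI subsetI)
    fix b assume b: "b \<in> {b \<in> set bs. u b = a \<and> P b}"
    then have "b \<in> set (drop k bs)" using u_low assms by blast
    then obtain j where "j < ?s" "b = bs ! (k + j)"
      using k_le by (auto simp: in_set_conv_nth)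
    then show "b \<in> (\<lambda>j. bs ! (k + j)) ` {j. j < ?s \<and> vs ! (k + j) = a \<and> P (bs ! (k + j))}"
      using b u_bs by (intro image_eqI[of _ _ j]) auto
  qed (use u_bs in auto)
  have injc: "inj_on (\<lambda>j. cs ! j) {j. j < ?s \<and> Q j}" for Q
    using chain_distinct length_chain by (auto simp: inj_on_def nth_eq_iff_index_eq)
  have injb: "inj_on (\<lambda>j. bs ! (k + j)) {j. j < ?s \<and> Q j}" for Q
    using distinct_bs by (auto simp: inj_on_def nth_eq_iff_index_eq)
  show "card {c \<in> set cs. chain_word cs c = a \<and> t < c} \<le> card {b \<in> set bs. u b = a \<and> t < b}"
    unfolding c b card_image[OF injc] card_image[OF injb]
    by (rule card_mono) (auto intro: less_le_trans chain_upper)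
  show "card {c \<in> set cs. chain_word cs c = a} = card {b \<in> set bs. u b = a}"
    using c[of "\<lambda>_. True"] b[of "\<lambda>_. True"] card_image[OF injc] card_image[OF injb] by simp
qed

lemma chain_imp_queue_fill:
  assumes w: "\<And>i. i \<in> {1..n} \<Longrightarrow> w i = chain_word cs i" and ord: "sorting_order n w ord" and i: "i \<in> {1..n}"
  shows "queue_fill n (set bs) w ord i = Some (u i)"
proof -
  define r where "r = card (set bs)"
  have r: "r = length bs" using distinct_bs by (simp add: r_def distinct_card)
  define f where "f = fold (phase1_step n (set bs) w) (rev (drop r ord)) Map.empty"
  note ph = queue_fill_phase1[OF bs_sites ord, folded r_def, folded f_def]
  note sp = sorting_order_split[OF ord, where r = r]
  have qd: "set bs - dom f = set bs" using ph(2) by auto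
  have tk: "set (take r ord) \<subseteq> {1..n}" using sp(1) by auto
  have low: "j \<in> set cs" if "j \<in> {1..n}" "w j < l - 1" for j
    using chain_word_low w that by auto
  \<comment> \<open>A Phase I letter below \<open>l - 1\<close> would, by sortedness, force all
    \<open>r\<close> sites of Phase II and its own onto the chain, which has at most
    \<open>r\<close> sites.\<close>
  have w_drop: "w j = l - 1" if j: "j \<in> set (drop r ord)" for j
  proof (rule ccontr)
    assume ne: "w j \<noteq> l - 1"
    have jn: "j \<in> {1..n}" using j sp(1) by auto
    have lt: "w j < l - 1" using ne w[OF jn] chain_word_le[OF jn] by simp
    have "insert j (set (take r ord)) \<subseteq> set cs"
    proof
      fix m assume m: "m \<in> insert j (set (take r ord))"
      then have "w m \<le> w j" using sp(5)[of m j] j by auto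
      then show "m \<in> set cs" using m jn tk lt by (intro low) auto
    qed
    then have "card (insert j (set (take r ord))) \<le> card (set cs)" by (intro card_mono) auto
    moreover have "card (insert j (set (take r ord))) = Suc r"
      using j sp(2,4) ph(4) by (subst card_insert_disjoint) (auto simp: distinct_card)
    moreover have "card (set cs) \<le> r" using chain_distinct length_chain r by (simp add: distinct_card)
    ultimately show False by simp
  qed
  show ?thesis
  proof (cases "i \<in> set bs")
    case False
    then have "i \<in> dom f" using ph(2) i by auto
    then obtain y where y: "f i = Some y" by blast
    then have "y \<in> ran f" by (auto simp: ran_def)
    then have "y = l" using ph(3) w_drop l_ge_2 by auto
    moreover have "queue_fill n (set bs) w ord i = f i"
      using ph(5) \<open>i \<in> dom f\<close> by (simp add: map_le_def)
    ultimately show ?thesis using y u_off[OF False] by simp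
  next
    case True
    have cars: "{c \<in> set (take r ord). w c = a \<and> P c} = {c \<in> set cs. chain_word cs c = a \<and> P c}" if a: "a < l - 1" for a P
    proof (intro equalityI subsetI)
      fix c assume "c \<in> {c \<in> set (take r ord). w c = a \<and> P c}"
      then show "c \<in> {c \<in> set cs. chain_word cs c = a \<and> P c}" using tk low[of c] w[of c] a by auto
    next
      fix c assume c: "c \<in> {c \<in> set cs. chain_word cs c = a \<and> P c}"
      then have cn: "c \<in> {1..n}" using chain_sites by auto
      then have "w c = a" using c w[OF cn] by simp
      then have "c \<notin> set (drop r ord)" using w_drop[of c] a by auto
      then have "c \<in> set (take r ord)" using cn unfolding sp(1)[symmetric] by simp
      then show "c \<in> {c \<in> set (take r ord). w c = a \<and> P c}"
        using c \<open>w c = a\<close> by simp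
    qed
    have "fold (phase2_step n (set bs) w) (take r ord) f i = Some (u i)"
    proof (rule phase2_greedy[where L = "l - 1", OF bs_sites _ _ tk sp(2,3)])
      show "card (set bs - dom f) = length (take r ord)" using qd ph(4) r_def by simp
      show "i \<in> set bs - dom f" using True qd by simp
      show "u b' \<le> u b" if "b \<in> set bs" "b' \<in> set bs" "b < b'" for b b'
        using that by (intro u_anti) auto
      show "u b \<le> l - 1" if "b \<in> set bs" for b using that by (rule u_le)
      show "w c \<le> l - 1" if "c \<in> set (take r ord)" for c
        using that tk chain_word_le[of c] w[of c] by auto
      show "b < c" if h: "c \<in> set (take r ord)" "w c < l - 1" "b \<in> set bs" "w c < u b" for c b
      proof -
        have cn: "c \<in> {1..n}" using h tk by auto
        then have "c \<in> set cs" using h by (intro low)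
        then obtain j where j: "j < length bs - k" "c = cs ! j"
          using length_chain by (metis in_set_conv_nth)
        obtain m where m: "m < length bs" "b = bs ! m" using h(3) by (metis in_set_conv_nth)
        show ?thesis
          using chain_sep[OF j(1) m(1)] h w[OF cn] chain_word_nth[OF j(1)] u_bs[OF m(1)] j m by simp
      qed
    next
      fix a t assume a: "a < l - 1"
      show "card {c \<in> set (take r ord). w c = a \<and> t < c} \<le> card {b \<in> set bs - dom f. u b = a \<and> t < b}"
        unfolding cars[OF a] qd by (rule chain_hall[OF a])
      show "card {c \<in> set (take r ord). w c = a} = card {b \<in> set bs - dom f. u b = a}"
        using cars[OF a, of "\<lambda>_. True"] chain_hall(2)[OF a] unfolding qd by simp
    qed
    then show ?thesis using ph(1) by simp
  qed
qed

end

text \<open>Both directions were proved for an arbitrary sorting order, so the choice made by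
  \<open>SOME\<close> is harmless.\<close>

lemma queue_act_eq_iff:
  assumes q: "q \<subseteq> {1..n}" "card q = length bs"
  shows "(\<forall>i\<in>{1..n}. queue_act n q w i = u i) \<longleftrightarrow>
    q = set bs \<and> (\<exists>cs\<in>chains (length bs - k). \<forall>i\<in>{1..n}. w i = chain_word cs i)"
proof -
  define ord where "ord = (SOME ord. sorting_order n w ord)"
  have ord: "sorting_order n w ord"
    unfolding ord_def by (rule someI_ex[OF sorting_order_ex])
  have "queue_act n q w i = u i \<longleftrightarrow> queue_fill n q w ord i = Some (u i)" if "i \<in> {1..n}" for i
  proof -
    have "i \<in> dom (queue_fill n q w ord)" using queue_fill_phase1(6)[OF q(1) ord] that by simp
    then show ?thesis by (auto simp: queue_act_def ord_def)
  qed
  then have "(\<forall>i\<in>{1..n}. queue_act n q w i = u i) \<longleftrightarrow> (\<forall>i\<in>{1..n}. queue_fill n q w ord i = Some (u i))"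
    by blast
  also have "\<dots> \<longleftrightarrow> q = set bs \<and>
      (\<exists>cs\<in>chains (length bs - k). \<forall>i\<in>{1..n}. w i = chain_word cs i)"
    using queue_fill_imp_chain[OF q ord] chain_imp_queue_fill[OF _ _ ord] by blast
  finally show ?thesis .
qed

end

section \<open>Spectral weights\<close>

lemma letter_count_list_word:
  assumes bs: "distinct bs" "set bs \<subseteq> {1..n}" "length vs = length bs" and "a \<noteq> l"
  shows "letter_count n (list_word l bs vs) a = count_list vs a"
proof -
  have "{i \<in> {1..n}. list_word l bs vs i = a} = (\<lambda>j. bs ! j) ` {j. j < length vs \<and> vs ! j = a}"
  proof (intro equalityI subsetI)
    fix i assume i: "i \<in> {i \<in> {1..n}. list_word l bs vs i = a}"
    then have "i \<in> set bs" using list_word_notin[OF bs(3)] \<open>a \<noteq> l\<close> by auto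
    then obtain j where j: "j < length bs" "i = bs ! j" by (metis in_set_conv_nth)
    then show "i \<in> (\<lambda>j. bs ! j) ` {j. j < length vs \<and> vs ! j = a}"
      using i list_word_nth[OF bs(1,3)] bs(3) by auto
  next
    fix i assume "i \<in> (\<lambda>j. bs ! j) ` {j. j < length vs \<and> vs ! j = a}"
    then obtain j where j: "j < length bs" "i = bs ! j" "vs ! j = a" using bs(3) by auto
    then have "i \<in> {1..n}" using bs(2) nth_mem by blast
    then show "i \<in> {i \<in> {1..n}. list_word l bs vs i = a}"
      using j list_word_nth[OF bs(1,3)] by simp
  qed
  moreover have "inj_on (\<lambda>j. bs ! j) {j. j < length vs \<and> vs ! j = a}"
    using bs by (auto simp: inj_on_def nth_eq_iff_index_eq)
  ultimately have "letter_count n (list_word l bs vs) a = card {j. j < length vs \<and> vs ! j = a}"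
    by (simp add: letter_count_def card_image)
  also have "\<dots> = length (filter (\<lambda>b. b = a) vs)"
    by (simp add: length_filter_conv_card)
  also have "\<dots> = count_list vs a"
    by (induction vs) auto
  finally show ?thesis .
qed

text \<open>The queue sizes involve only letters below \<open>l\<close>, which are counted in
  \<open>vs\<close>. The letter \<open>l\<close> fills the remaining sites, so the total is
  automatically \<open>n\<close>.\<close>

lemma is_mlq_list_word:
  assumes bs: "distinct bs" "set bs \<subseteq> {1..n}" "length vs = length bs"
    and vs: "set vs \<subseteq> {1..l - 1}" and "0 < l"
  shows "is_mlq n l (letter_count n (list_word l bs vs)) qs \<longleftrightarrow>
    length qs = l - 1 \<and>
    (\<forall>i\<in>{1..l - 1}. qs ! (i - 1) \<subseteq> {1..n} \<and> card (qs ! (i - 1)) = (\<Sum>a = 1..i. count_list vs a))"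
proof -
  let ?m = "letter_count n (list_word l bs vs)"
  have m: "?m a = count_list vs a" if "a \<noteq> l" for a
    using letter_count_list_word[OF bs that] .
  have psum: "psum ?m i = (\<Sum>a = 1..i. count_list vs a)" if "i < l" for i
    unfolding psum_def using that by (intro sum.cong) (auto simp: m)
  have "{i \<in> {1..n}. list_word l bs vs i = l} = {1..n} - set bs"
  proof (intro equalityI subsetI)
    fix i assume i: "i \<in> {i \<in> {1..n}. list_word l bs vs i = l}"
    have "i \<notin> set bs"
    proof
      assume "i \<in> set bs"
      then obtain j where j: "j < length bs" "i = bs ! j" by (metis in_set_conv_nth)
      then have "vs ! j = l" using i list_word_nth[OF bs(1,3)] by simp
      moreover have "vs ! j \<in> set vs" using j bs(3) by simp
      then have "vs ! j \<in> {1..l - 1}" using vs by blast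
      ultimately show False using \<open>0 < l\<close> by simp
    qed
    then show "i \<in> {1..n} - set bs" using i by simp
  qed (use list_word_notin[OF bs(3)] in auto)
  then have "?m l = n - length bs"
    using bs by (simp add: letter_count_def card_Diff_subset distinct_card)
  moreover have "psum ?m (l - 1) = length vs"
    using sum_count_set[OF vs] psum[of "l - 1"] \<open>0 < l\<close> by simp
  moreover have "psum ?m l = psum ?m (l - 1) + ?m l"
    unfolding psum_def using \<open>0 < l\<close> by (cases l) auto
  moreover have "length bs \<le> n"
    using card_mono[OF _ bs(2)] bs(1) by (simp add: distinct_card)
  ultimately have "psum ?m l = n" using bs(3) by simp
  moreover have "?m i = 0" if "i > l" for i
  proof -
    have "i \<notin> set vs" using vs that by auto
    then show ?thesis using m that by simp
  qed
  moreover have "psum ?m i = (\<Sum>a = 1..i. count_list vs a)" if "i \<in> {1..l - 1}" for i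
    using that by (intro psum) auto
  ultimately show ?thesis
    unfolding is_mlq_def by auto
qed

definition mlqs :: "nat \<Rightarrow> nat \<Rightarrow> (nat \<Rightarrow> nat) \<Rightarrow> nat set list set" where
  "mlqs n l u = {qs. is_mlq n l (letter_count n u) qs \<and> (\<forall>i\<in>{1..n}. mlq_act n qs (\<lambda>_. 1) i = u i)}"

lemma spectral_weight_mlqs: "spectral_weight x n l u = (\<Sum>qs\<in>mlqs n l u. mlq_weight x qs)"
  by (simp add: spectral_weight_def mlqs_def)

lemma finite_mlqs: "finite (mlqs n l u)"
proof (rule finite_subset)
  show "mlqs n l u \<subseteq> {qs. set qs \<subseteq> Pow {1..n} \<and> length qs = l - 1}"
  proof
    fix qs assume "qs \<in> mlqs n l u"
    then have qs: "length qs = l - 1" "\<And>i. i \<in> {1..l - 1} \<Longrightarrow> qs ! (i - 1) \<subseteq> {1..n}"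
      by (auto simp: mlqs_def is_mlq_def)
    have "q \<subseteq> {1..n}" if q: "q \<in> set qs" for q
    proof -
      obtain i where "i < length qs" "q = qs ! i" using q by (metis in_set_conv_nth)
      then show ?thesis using qs(1) qs(2)[of "Suc i"] by simp
    qed
    then show "qs \<in> {qs. set qs \<subseteq> Pow {1..n} \<and> length qs = l - 1}"
      using qs(1) by blast
  qed
qed (simp add: finite_lists_length_eq)

lemma spectral_weight_cong:
  assumes "\<And>i. i \<in> {1..n} \<Longrightarrow> u i = u' i"
  shows "spectral_weight x n l u = spectral_weight x n l u'"
proof -
  have "{k \<in> {1..n}. u k = i} = {k \<in> {1..n}. u' k = i}" for i
    using assms by auto
  then have "letter_count n u = letter_count n u'"
    by (simp add: letter_count_def fun_eq_iff)
  then show ?thesis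
    unfolding spectral_weight_def using assms by simp
qed

section \<open>The recursion for the spectral weight\<close>

context decreasing_word
begin

lemma count_drop: "a < l - 1 \<Longrightarrow> count_list (drop k vs) a = count_list vs a"
proof -
  assume a: "a < l - 1"
  have "x = l - 1" if "x \<in> set (take k vs)" for x
    using that vs_top by (auto simp: in_set_conv_nth)
  then have "a \<notin> set (take k vs)" using a by auto
  then have "count_list (take k vs) a = 0" by (simp add: count_list_0_iff)
  moreover have "count_list vs a = count_list (take k vs) a + count_list (drop k vs) a"
    by (metis append_take_drop_id count_list_append)
  ultimately show ?thesis by simp
qed

lemma set_drop_vs: "set (drop k vs) = {1..l - 2}"
proof (intro equalityI subsetI)
  fix a assume "a \<in> set (drop k vs)"
  then obtain j where "j < length vs - k" "a = vs ! (k + j)"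
    using k_le length_vs by (auto simp: in_set_conv_nth)
  then have "k + j < length bs" "a = vs ! (k + j)" using length_vs by auto
  then show "a \<in> {1..l - 2}"
    using vs_bounds(1)[of "k + j"] vs_low[of "k + j"] by simp
next
  fix a assume a: "a \<in> {1..l - 2}"
  then have "a \<in> set vs" using set_vs by auto
  moreover have "a < l - 1" using a by auto
  ultimately have "count_list (drop k vs) a \<noteq> 0"
    by (simp add: count_drop count_list_0_iff)
  then show "a \<in> set (drop k vs)" by (simp add: count_list_0_iff)
qed

lemma is_mlq_chain:
  assumes "cs \<in> chains (length bs - k)"
  shows "is_mlq n (l - 1) (letter_count n (chain_word cs)) qs \<longleftrightarrow>
    length qs = l - 2 \<and>
    (\<forall>i\<in>{1..l - 2}. qs ! (i - 1) \<subseteq> {1..n} \<and> card (qs ! (i - 1)) = (\<Sum>a = 1..i. count_list vs a))"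
proof -
  have "is_mlq n (l - 1) (letter_count n (chain_word cs)) qs \<longleftrightarrow>
    length qs = l - 1 - 1 \<and> (\<forall>i\<in>{1..l - 1 - 1}.
      qs ! (i - 1) \<subseteq> {1..n} \<and> card (qs ! (i - 1)) = (\<Sum>a = 1..i. count_list (drop k vs) a))"
    using l_ge_2 set_drop_vs
    by (intro is_mlq_list_word chain_distinct chain_sites length_drop_chain assms) auto
  also have "l - 1 - 1 = l - 2" by simp
  moreover have "(\<Sum>a = 1..i. count_list (drop k vs) a) = (\<Sum>a = 1..i. count_list vs a)"
    if "i \<in> {1..l - 2}" for i
    using that by (intro sum.cong count_drop) auto
  ultimately show ?thesis by auto
qed

text \<open>The condition on \<open>qs\<close> is literally the one in \<open>is_mlq_chain\<close>,
  which does not depend on the chain. Removing the last queue therefore leaves a multiline queue of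
  the right type for whichever chain word it produces.\<close>

lemma is_mlq_snoc:
  "is_mlq n l (letter_count n u) (qs @ [q]) \<longleftrightarrow> (length qs = l - 2 \<and>
    (\<forall>i\<in>{1..l - 2}. qs ! (i - 1) \<subseteq> {1..n} \<and> card (qs ! (i - 1)) = (\<Sum>a = 1..i. count_list vs a))) \<and>
    q \<subseteq> {1..n} \<and> card q = length bs"
proof -
  have "is_mlq n l (letter_count n u) (qs @ [q]) \<longleftrightarrow> length (qs @ [q]) = l - 1 \<and>
    (\<forall>i\<in>{1..l - 1}. (qs @ [q]) ! (i - 1) \<subseteq> {1..n} \<and>
      card ((qs @ [q]) ! (i - 1)) = (\<Sum>a = 1..i. count_list vs a))"
    using l_ge_2 set_vs by (intro is_mlq_list_word distinct_bs bs_sites length_vs) auto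
  also have "\<dots> \<longleftrightarrow> (length qs = l - 2 \<and>
    (\<forall>i\<in>{1..l - 2}. qs ! (i - 1) \<subseteq> {1..n} \<and> card (qs ! (i - 1)) = (\<Sum>a = 1..i. count_list vs a))) \<and>
    q \<subseteq> {1..n} \<and> card q = length bs"
  proof (cases "length qs = l - 2")
    case True
    have "{1..l - 1} = insert (l - 1) {1..l - 2}" using l_ge_2 by auto
    moreover have "(\<Sum>a = 1..l - 1. count_list vs a) = length bs"
      using sum_count_set[of vs "{1..l - 1}"] set_vs length_vs by simp
    moreover have "(qs @ [q]) ! (l - 1 - 1) = q"
      using True by (simp add: nth_append numeral_2_eq_2)
    moreover have "(qs @ [q]) ! (i - 1) = qs ! (i - 1)" if "i \<in> {1..l - 2}" for i
      using True that by (auto simp: nth_append)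
    ultimately show ?thesis using True l_ge_2 by auto
  qed (use l_ge_2 in auto)
  finally show ?thesis .
qed

text \<open>A chain is recovered as the set of sites with letter below \<open>l - 1\<close>. Hence
  distinct chains come from disjoint sets of multiline queues, and the weights add up.\<close>

lemma chain_word_inj:
  assumes "cs \<in> chains (length bs - k)" "ds \<in> chains (length bs - k)"
    and "\<And>i. i \<in> {1..n} \<Longrightarrow> chain_word cs i = chain_word ds i"
  shows "cs = ds"
proof -
  have "{i \<in> {1..n}. chain_word cs i < l - 1} = {i \<in> {1..n}. chain_word ds i < l - 1}"
    using assms(3) by auto
  then have "set cs = set ds"
    using chain_word_low[OF assms(1)] chain_word_low[OF assms(2)] by simp
  then show ?thesis
    using chain_sorted[OF assms(1)] chain_sorted[OF assms(2)] strict_sorted_equal by blast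
qed

lemma mlqs_eq:
  "mlqs n l u = (\<lambda>qs. qs @ [set bs]) ` (\<Union>cs\<in>chains (length bs - k). mlqs n (l - 1) (chain_word cs))"
proof (intro equalityI subsetI)
  fix ps assume ps: "ps \<in> mlqs n l u"
  then have "length ps = l - 1" by (simp add: mlqs_def is_mlq_def)
  then have "ps \<noteq> []" using l_ge_2 by auto
  then obtain qs q where ps': "ps = qs @ [q]" by (metis append_butlast_last_id)
  have mlq: "is_mlq n l (letter_count n u) (qs @ [q])"
    and act: "\<forall>i\<in>{1..n}. queue_act n q (mlq_act n qs (\<lambda>_. 1)) i = u i"
    using ps by (auto simp: mlqs_def ps' mlq_act_def)
  have "q \<subseteq> {1..n} \<and> card q = length bs"
    using mlq unfolding is_mlq_snoc by blast
  then have q: "q = set bs"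
    and "\<exists>cs\<in>chains (length bs - k). \<forall>i\<in>{1..n}. mlq_act n qs (\<lambda>_. 1) i = chain_word cs i"
    using queue_act_eq_iff[of q "mlq_act n qs (\<lambda>_. 1)"] act by auto
  then obtain cs where cs: "cs \<in> chains (length bs - k)"
    "\<forall>i\<in>{1..n}. mlq_act n qs (\<lambda>_. 1) i = chain_word cs i" by blast
  then have "qs \<in> mlqs n (l - 1) (chain_word cs)"
    using mlq unfolding mlqs_def is_mlq_snoc is_mlq_chain[OF cs(1)] by blast
  then show "ps \<in> (\<lambda>qs. qs @ [set bs]) ` (\<Union>cs\<in>chains (length bs - k). mlqs n (l - 1) (chain_word cs))"
    using cs(1) ps' q by blast
next
  fix ps assume "ps \<in> (\<lambda>qs. qs @ [set bs]) ` (\<Union>cs\<in>chains (length bs - k). mlqs n (l - 1) (chain_word cs))"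
  then obtain cs qs where cs: "cs \<in> chains (length bs - k)" and qs: "qs \<in> mlqs n (l - 1) (chain_word cs)"
    and ps: "ps = qs @ [set bs]" by blast
  have card: "card (set bs) = length bs" using distinct_bs by (rule distinct_card)
  have "is_mlq n l (letter_count n u) ps"
    using qs bs_sites card unfolding ps is_mlq_snoc mlqs_def is_mlq_chain[OF cs] by blast
  moreover have "\<forall>i\<in>{1..n}. queue_act n (set bs) (mlq_act n qs (\<lambda>_. 1)) i = u i"
    using queue_act_eq_iff[OF bs_sites card, of "mlq_act n qs (\<lambda>_. 1)"] qs cs by (auto simp: mlqs_def)
  ultimately show "ps \<in> mlqs n l u"
    by (simp add: mlqs_def ps mlq_act_def)
qed

lemma spectral_weight_recursion:
  "spectral_weight x n l u = (\<Prod>b\<in>set bs. x b) *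
    (\<Sum>cs\<in>chains (length bs - k). spectral_weight x n (l - 1) (chain_word cs))"
proof -
  let ?M = "\<lambda>cs. mlqs n (l - 1) (chain_word cs)"
  have disj: "?M cs \<inter> ?M ds = {}"
    if "cs \<in> chains (length bs - k)" "ds \<in> chains (length bs - k)" "cs \<noteq> ds" for cs ds
    using chain_word_inj[OF that(1,2)] that(3) by (auto simp: mlqs_def)
  have "spectral_weight x n l u =
      (\<Sum>qs\<in>(\<Union>cs\<in>chains (length bs - k). ?M cs). mlq_weight x (qs @ [set bs]))"
    unfolding spectral_weight_mlqs mlqs_eq by (subst sum.reindex) (auto simp: inj_on_def)
  also have "\<dots> = (\<Sum>cs\<in>chains (length bs - k). \<Sum>qs\<in>?M cs. mlq_weight x (qs @ [set bs]))"
    by (rule sum.UNION_disjoint) (use finite_chains finite_mlqs disj in auto)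
  also have "\<dots> = (\<Sum>cs\<in>chains (length bs - k). \<Sum>qs\<in>?M cs. (\<Prod>b\<in>set bs. x b) * mlq_weight x qs)"
    by (simp add: mlq_weight_def mult.commute)
  finally show ?thesis
    by (simp add: spectral_weight_mlqs sum_distrib_left)
qed

end

theorem spectral_weight_list_word:
  fixes x :: "nat \<Rightarrow> 'a::comm_ring_1"
  assumes "0 < l" "sorted_wrt (<) bs" "set bs \<subseteq> {1..n}" "length vs = length bs"
    "sorted_wrt (\<ge>) vs" "set vs = {1..l - 1}"
  shows "spectral_weight x n l (list_word l bs vs) = (\<Prod>b\<in>set bs. x b) *
    cdet (length bs) (\<lambda>j. hcol x (int l - int (vs ! j) - int j - 1) (bs ! j))"
  using assms
proof (induction l arbitrary: bs vs)
  case (Suc l)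
  show ?case
  proof (cases "l = 0")
    case True
    then have [simp]: "vs = []" "bs = []" using Suc.prems by auto
    \<comment> \<open>The recursion ends at the word of all ones with no listed site: the empty
      multiline queue has weight 1, as has the determinant of size 0.\<close>
    have mlq: "is_mlq n 1 (letter_count n (list_word 1 [] [])) qs \<longleftrightarrow> qs = []" for qs
      using is_mlq_list_word[of "[]" n "[]" 1 qs] by simp
    have "mlqs n 1 (list_word 1 [] []) = {[]}"
      unfolding mlqs_def mlq by (auto simp: mlq_act_def list_word_def)
    then show ?thesis
      using True by (simp add: spectral_weight_mlqs mlq_weight_def cdet_def)
  next
    case False
    define k where "k = length (takeWhile (\<lambda>a. a = l) vs)"
    have kle: "k \<le> length bs"
      unfolding k_def using length_takeWhile_le[of "\<lambda>a. a = l" vs] Suc.prems(4) by simp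
    have top: "vs ! j = l" if "j < k" for j
    proof -
      have j: "j < length (takeWhile (\<lambda>a. a = l) vs)" using that by (simp add: k_def)
      show ?thesis using set_takeWhileD[OF nth_mem[OF j]] takeWhile_nth[OF j] by simp
    qed
    have set_vs: "set vs = {1..l}" using Suc.prems by simp
    have anti: "vs ! j \<le> vs ! i" if "i \<le> j" "j < length vs" for i j
      using Suc.prems(5) that by (cases "i = j") (auto simp: sorted_wrt_iff_nth_less)
    have low: "vs ! j < l" if "k \<le> j" "j < length bs" for j
    proof -
      have "vs ! k \<noteq> l"
        using that Suc.prems nth_length_takeWhile[of "\<lambda>a. a = l" vs] by (simp add: k_def)
      moreover have "vs ! k \<le> l"
        using set_vs nth_mem[of k vs] that Suc.prems by auto
      moreover have "vs ! j \<le> vs ! k" using that Suc.prems by (intro anti) auto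
      ultimately show ?thesis by simp
    qed
    have "0 < k"
    proof (rule ccontr)
      assume "\<not> 0 < k"
      have "l \<in> set vs" using set_vs False by simp
      then obtain j where "j < length bs" "vs ! j = l"
        using Suc.prems(4) by (metis in_set_conv_nth)
      then show False using low[of j] \<open>\<not> 0 < k\<close> by simp
    qed
    interpret decreasing_word n "Suc l" k bs vs
      using Suc.prems kle top low \<open>0 < k\<close> by unfold_locales auto
    have "spectral_weight x n l (chain_word cs) = prod_list (map x cs) *
        cdet (length bs - k) (\<lambda>j. hcol x (int l - int (drop k vs ! j) - int j - 1) (cs ! j))"
      if cs: "cs \<in> chains (length bs - k)" for cs
    proof -
      have "spectral_weight x n l (list_word l cs (drop k vs)) = (\<Prod>b\<in>set cs. x b) *
          cdet (length cs) (\<lambda>j. hcol x (int l - int (drop k vs ! j) - int j - 1) (cs ! j))"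
        using False set_drop_vs
        by (intro Suc.IH chain_sorted[OF cs] chain_sites[OF cs] length_drop_chain[OF cs] sorted_wrt_drop vs_decreasing)
          auto
      then show ?thesis
        using length_chain[OF cs] chain_distinct[OF cs] by (simp add: prod.distinct_set_conv_list)
    qed
    then show ?thesis
      using spectral_weight_recursion[of x] cdet_recursion[of x] by simp
  qed
qed simp

theorem theorem3p10:
  fixes n l r :: nat
    and B :: "nat set"
    and b v u :: "nat \<Rightarrow> nat"
    and \<gamma> :: "nat \<Rightarrow> int"
  assumes "n > 0" and "l > 0" and "r > 0"
    and "strict_mono_on {1..r} b"
    and "B = b ` {1..r}"
    and "B \<subseteq> {1..n}"
    and "antimono_on {1..r} v"
    and "v ` {1..r} = {1..l - 1}"
    and "\<And>j. j \<in> {1..r} \<Longrightarrow> u (b j) = v j"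
    and "\<And>i. i \<in> {1..n} - B \<Longrightarrow> u i = l"
    and "\<And>j. j \<in> {1..r} \<Longrightarrow> \<gamma> j = int l - int (v j)"
  shows "spectral_weight indet n l u =
    (\<Prod>k\<in>B. indet k) *
    det (mat r r (\<lambda>(i, j).
      complete_hom indet (\<gamma> (j + 1) + int (i + 1) - int (j + 1) - 1) (b (j + 1))))"
proof -
  define bs where "bs = map b [1..<Suc r]"
  define vs where "vs = map v [1..<Suc r]"
  have set_bs: "set bs = B" and set_vs: "set vs = {1..l - 1}"
    using assms(5,8) by (auto simp: bs_def vs_def atLeastLessThanSuc_atLeastAtMost simp del: upt_Suc)
  have len: "length bs = r" "length vs = r"
    by (simp_all add: bs_def vs_def)
  have nth: "bs ! j = b (j + 1)" "vs ! j = v (j + 1)" if "j < r" for j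
    using that by (simp_all add: bs_def vs_def del: upt_Suc)
  have sorted_bs: "sorted_wrt (<) bs"
    using assms(4) by (auto simp: sorted_wrt_iff_nth_less len nth monotone_on_def)
  have sorted_vs: "sorted_wrt (\<ge>) vs"
    using assms(7) by (auto simp: sorted_wrt_iff_nth_less len nth monotone_on_def)
  have "u i = list_word l bs vs i" if i: "i \<in> {1..n}" for i
  proof (cases "i \<in> B")
    case True
    then obtain j where j: "j < r" "i = bs ! j"
      unfolding set_bs[symmetric] using len by (metis in_set_conv_nth)
    have "distinct bs" using sorted_bs by (simp add: strict_sorted_iff)
    then have "list_word l bs vs i = v (j + 1)"
      using list_word_nth[of bs vs j l] j len nth by simp
    then show ?thesis using assms(9)[of "j + 1"] j nth by simp
  next
    case False
    then show ?thesis using list_word_notin[of vs bs i l] set_bs len assms(10) i by simp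
  qed
  then have "spectral_weight indet n l u = spectral_weight indet n l (list_word l bs vs)"
    by (rule spectral_weight_cong)
  also have "\<dots> = (\<Prod>k\<in>B. indet k) *
      cdet r (\<lambda>j. hcol indet (int l - int (vs ! j) - int j - 1) (bs ! j))"
    using spectral_weight_list_word[OF assms(2) sorted_bs, where n = n and vs = vs] sorted_vs set_bs set_vs len assms(6)
    by simp
  also have "cdet r (\<lambda>j. hcol indet (int l - int (vs ! j) - int j - 1) (bs ! j)) =
      cdet r (\<lambda>j i. complete_hom indet (\<gamma> (j + 1) + int (i + 1) - int (j + 1) - 1) (b (j + 1)))"
  proof (rule cdet_cong)
    fix i j assume "i < r" "j < r"
    \<comment> \<open>Counting rows and columns from 0 instead of 1 leaves \<open>i - j\<close>
      unchanged.\<close>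
    then have "int l - int (vs ! j) - int j - 1 + int i = \<gamma> (j + 1) + int (i + 1) - int (j + 1) - 1"
      using assms(11)[of "j + 1"] nth by simp
    then show "hcol indet (int l - int (vs ! j) - int j - 1) (bs ! j) i =
        complete_hom indet (\<gamma> (j + 1) + int (i + 1) - int (j + 1) - 1) (b (j + 1))"
      using nth(1)[OF \<open>j < r\<close>] by (simp only: hcol_def)
  qed
  finally show ?thesis by (simp only: cdet_def)
qed

end
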